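(* Fix an integer $g \geq 2$. Let $f\colon \mathbb{N}\to\mathbb{N}$ be any arithmetic function of the form $f = f_1 \circ f_2 \circ \dots \circ f_j$ for some $j \geq 1$, where each $f_i \in \{\phi, \sigma, \lambda\}$. Then both of the real numbers \[ 0.f(1) f(2) f(3) f(4)\ldots \qquad\text{and}\qquad 0.f(2) f(3) f(5) f(7)\ldots, \] obtained by concatenating the base-$g$ digits of the successive values $f(n)$ for $n=1,2,3,\dots$ (respectively, for $n$ running over the primes $2,3,5,7,\dots$ in increasing order), are $g$-normal.
   Context: $\phi$ is Euler's totient function, $\sigma(n)=\sum_{d\mid n} d$ is the sum-of-divisors function, and $\lambda(n)$ is Carmichael's lambda-function, the exponent of the group $(\mathbb{Z}/n\mathbb{Z})^{\times}$. A real number is $g$-normal if, for every $k\ge1$, every word of length $k$ on the alphabet $\{0,1,\dots,g-1\}$ occurs in its base-$g$ expansion with limiting frequency $g^{-k}$. *)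

theory Defs
  imports Complex_Main "HOL-Library.Infinite_Set" "HOL-Number_Theory.Number_Theory"
begin

definition divisor_sigma :: "nat \<Rightarrow> nat" where
  "divisor_sigma n = \<Sum>{d. d dvd n}"

text \<open>
  Base-\<open>g\<close> digits of a natural number, most significant digit first, without leading zeros
  (\<open>0\<close> has the single digit \<open>0\<close>). The guard \<open>g < 2\<close> only serves termination.
\<close>
fun digits_of :: "nat \<Rightarrow> nat \<Rightarrow> nat list" where
  "digits_of g n = (if g < 2 \<or> n < g then [n] else digits_of g (n div g) @ [n mod g])"

declare digits_of.simps [simp del]

text \<open>
  The digit at position \<open>i\<close>, counted from \<open>0\<close>, of the infinite word obtained by concatenating
  the digits of \<open>a 0\<close>, \<open>a 1\<close>, \<open>a 2\<close>, \<dots>. Every block is nonempty, so the first \<open>Suc i\<close> blocks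
  already contain position \<open>i\<close>.
\<close>
definition concat_digit :: "nat \<Rightarrow> (nat \<Rightarrow> nat) \<Rightarrow> nat \<Rightarrow> nat" where
  "concat_digit g a i = concat (map (\<lambda>k. digits_of g (a k)) [0..<Suc i]) ! i"

definition concat_real :: "nat \<Rightarrow> (nat \<Rightarrow> nat) \<Rightarrow> real" where
  "concat_real g a = (\<Sum>i. real (concat_digit g a i) / real g ^ Suc i)"

text \<open>
  The \<open>(i + 1)\<close>-st digit after the point in the base-\<open>g\<close> expansion of (the fractional part of)
  \<open>x\<close>. Where there are two expansions, this selects the one that does not end in a
  constant tail of digits \<open>g - 1\<close>.
\<close>
definition real_digit :: "nat \<Rightarrow> real \<Rightarrow> nat \<Rightarrow> nat" where
  "real_digit g x i = nat (\<lfloor>x * real g ^ Suc i\<rfloor> mod int g)"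

definition normal_in_base :: "nat \<Rightarrow> real \<Rightarrow> bool" where
  "normal_in_base g x \<longleftrightarrow>
     (\<forall>w. length w \<ge> 1 \<and> set w \<subseteq> {..<g} \<longrightarrow>
        (\<lambda>N. real (card {i. i < N \<and> (\<forall>j<length w. real_digit g x (i + j) = w ! j)}) / real N)
          \<longlonglongrightarrow> 1 / real g ^ length w)"

end

theory Submission
  imports Defs "HOL-Analysis.Harmonic_Numbers" "HOL-Real_Asymp.Real_Asymp"
begin

text \<open>
  For normality it suffices that every word has at least the expected lower density, because the
  densities of all words of a given length add up to 1. By a Chernoff bound only
  \<open>X\<^bsup>1-\<delta>\<^esup>\<close> integers up to \<open>X\<close> contain a given word too rarely. It therefore suffices that,
  outside a set of \<open>n \<le> x\<close> of size \<open>o(x / ln x)\<close> (so that primes \<open>n\<close> are covered as well), every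
  value of \<open>f\<close> is attained \<open>x\<^bsup>o(1)\<^esup>\<close> times; in particular small values are then rare, and no
  lower bound for \<open>f\<close> is required.

  An \<open>n\<close> with \<open>\<phi>(n) = m\<close> is a product of prime powers each of which is determined, up to its
  exponent, by a divisor of \<open>m\<close>. So the multiplicity is \<open>x\<^bsup>o(1)\<^esup>\<close> if \<open>n\<close> and \<open>m\<close> have at most
  a power of \<open>ln (ln x)\<close> prime factors. This property is propagated through the iteration: it can only
  fail if some large prime \<open>r\<close> divides the current value while \<open>r \<plusminus> 1\<close> has many prime factors.
  The integers with that many prime factors are so sparse that the trivial bound for the number of
  multiples of \<open>r\<close>, losing powers of \<open>ln x\<close>, is good enough, and no sieve is needed.
\<close>

section \<open>Words in digit expansions\<close>

text \<open>Two scales carry the argument, with u = ln (ln x): thresholds and fibre bounds have size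
  exp (u^e), numbers of prime factors have size u^e. For e \<ge> 2 the quantity exp (u^e) exceeds
  every power of ln x and is still x^o(1). The former pays for the powers of ln x lost in union
  bounds, the latter keeps the fibres harmless next to the power of x saved by the Chernoff bound.
  Products of powers of u are powers of u, so a fixed number of steps only enlarges e. The obstacle
  is prime powers: r^a in one value contributes a factor to the next value that is controlled only
  by its size. This is acceptable for small r, while large r have to be simple. To keep them simple
  one must bound how often q^2 divides the next value for a large prime q, and q^2 may come from one
  prime r or from two primes r, r'. Hence divisibility by a product of two large primes is counted
  along with divisibility by one.\<close>

definition occurrences :: "'a list \<Rightarrow> 'a list \<Rightarrow> nat" where
  "occurrences w xs = card {i. i + length w \<le> length xs \<and> (\<forall>j<length w. xs ! (i + j) = w ! j)}"

lemma finite_occurrences [simp]: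
  "finite {i. i + length w \<le> length xs \<and> (\<forall>j<length w. xs ! (i + j) = w ! j)}"
  by (rule finite_subset[of _ "{..length xs}"]) auto

text \<open>Occurrences across the seam are given up, which is harmless because only lower densities
  are needed. The empty word would be counted twice at the seam.\<close>

lemma occurrences_append:
  assumes "w \<noteq> []"
  shows "occurrences w xs + occurrences w ys \<le> occurrences w (xs @ ys)"
proof -
  let ?O = "\<lambda>zs. {i. i + length w \<le> length zs \<and> (\<forall>j<length w. zs ! (i + j) = w ! j)}"
  have "occurrences w xs + occurrences w ys = card (?O xs) + card ((\<lambda>i. length xs + i) ` ?O ys)"
    by (simp add: occurrences_def card_image)
  also have "\<dots> = card (?O xs \<union> (\<lambda>i. length xs + i) ` ?O ys)"
    using assms by (subst card_Un_disjoint) auto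
  also have "\<dots> \<le> card (?O (xs @ ys))"
    using assms by (intro card_mono finite_occurrences) (auto simp: nth_append)
  finally show ?thesis by (simp add: occurrences_def)
qed

lemma occurrences_concat:
  assumes "w \<noteq> []"
  shows "(\<Sum>x\<leftarrow>xss. occurrences w x) \<le> occurrences w (concat xss)"
  by (induction xss) (auto intro: order_trans[OF _ occurrences_append[OF assms]])

lemma digits_of_small [simp]: "n < g \<Longrightarrow> digits_of g n = [n]"
  by (subst digits_of.simps) simp

lemma digits_of_rec: "g \<ge> 2 \<Longrightarrow> g \<le> n \<Longrightarrow> digits_of g n = digits_of g (n div g) @ [n mod g]"
  by (subst digits_of.simps) simp

lemma digits_of_not_Nil [simp]: "digits_of g n \<noteq> []"
  by (subst digits_of.simps) simp

lemma set_digits_of: "g \<ge> 2 \<Longrightarrow> set (digits_of g n) \<subseteq> {..<g}"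
proof (induction n rule: less_induct)
  case (less n)
  show ?case
    by (cases "n < g") (use less in \<open>auto simp: digits_of_rec\<close>)
qed

lemma length_digits_of_bounds:
  assumes "g \<ge> 2" "n > 0"
  shows "g ^ (length (digits_of g n) - 1) \<le> n \<and> n < g ^ length (digits_of g n)"
  using assms(2)
proof (induction n rule: less_induct)
  case (less n)
  show ?case
  proof (cases "n < g")
    case True then show ?thesis using less assms by simp
  next
    case False
    define l where "l = length (digits_of g (n div g))"
    have l0: "l > 0" by (simp add: l_def)
    have "n div g > 0" using False assms by (simp add: div_greater_zero_iff)
    moreover have "n div g < n" using assms less.prems by simp
    ultimately have IH: "g ^ (l - 1) \<le> n div g" "n div g < g ^ l"
      using less.IH unfolding l_def by blast+
    have 1: "g ^ l \<le> n"
    proof -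
      have "g ^ l = g ^ (l - 1) * g" using l0 by (metis Suc_diff_1 power_Suc2)
      also have "\<dots> \<le> n" using IH(1) by (meson div_times_less_eq_dividend mult_le_mono1 order_trans)
      finally show ?thesis .
    qed
    have 2: "n < g ^ Suc l"
      using IH(2) assms by (simp add: div_less_iff_less_mult mult.commute)
    show ?thesis using False assms 1 2 by (simp add: digits_of_rec l_def)
  qed
qed

lemma nth_digits_of:
  assumes "g \<ge> 2" "i < length (digits_of g n)"
  shows "digits_of g n ! (length (digits_of g n) - 1 - i) = (n div g ^ i) mod g"
  using assms(2)
proof (induction n arbitrary: i rule: less_induct)
  case (less n)
  show ?case
  proof (cases "n < g")
    case True then show ?thesis using less assms by simp
  next
    case False
    define l where "l = length (digits_of g (n div g))"
    have l0: "l > 0" by (simp add: l_def)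
    have "n div g < n" using assms False by simp
    note IH = less.IH[OF this, folded l_def]
    show ?thesis
    proof (cases i)
      case 0 then show ?thesis using False assms by (simp add: digits_of_rec nth_append)
    next
      case (Suc i')
      then have i': "i' < l" using less.prems False assms by (simp add: digits_of_rec l_def)
      show ?thesis using IH[OF i'] i' Suc False assms l0
        by (simp add: digits_of_rec nth_append div_mult2_eq flip: l_def)
    qed
  qed
qed

definition word_value :: "nat \<Rightarrow> nat list \<Rightarrow> nat" where
  "word_value g w = foldl (\<lambda>a d. a * g + d) 0 w"

lemma word_value_snoc [simp]: "word_value g (w @ [d]) = word_value g w * g + d"
  and word_value_Nil [simp]: "word_value g [] = 0"
  by (simp_all add: word_value_def)

lemma word_value_digit:
  assumes "g \<ge> 2" "set w \<subseteq> {..<g}" "i < length w"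
  shows "(word_value g w div g ^ i) mod g = w ! (length w - 1 - i)"
  using assms(2,3)
proof (induction w arbitrary: i rule: rev_induct)
  case (snoc d w)
  show ?case
  proof (cases i)
    case 0 then show ?thesis using snoc by simp
  next
    case (Suc j)
    then show ?thesis using snoc assms(1)
      by (auto simp: div_mult2_eq nth_append)
  qed
qed simp

lemma word_value_less: "g \<ge> 2 \<Longrightarrow> set w \<subseteq> {..<g} \<Longrightarrow> word_value g w < g ^ length w"
proof (induction w rule: rev_induct)
  case (snoc d w)
  then have "word_value g w + 1 \<le> g ^ length w" "d < g" by auto
  then have "(word_value g w + 1) * g \<le> g ^ length w * g" by (intro mult_right_mono) auto
  then show ?case using \<open>d < g\<close> by (simp add: algebra_simps)
qed simp

text \<open>Windows are addressed from the least significant digit: position \<open>p\<close>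
  corresponds to list index \<open>l - k - p\<close>. The left-hand side is pure arithmetic and
  makes sense for every m < g^l, leading zeros included, so that it can be averaged over a full
  range of residues.\<close>

lemma occurrences_digits_of:
  assumes "g \<ge> 2" "w \<noteq> []" "set w \<subseteq> {..<g}"
  shows "card {p. p + length w \<le> length (digits_of g n) \<and>
            (n div g ^ p) mod g ^ length w = word_value g w}
         \<le> occurrences w (digits_of g n)"
proof -
  define l where "l = length (digits_of g n)"
  define k where "k = length w"
  let ?P = "{p. p + k \<le> l \<and> (n div g ^ p) mod g ^ k = word_value g w}"
  let ?O = "{i. i + k \<le> l \<and> (\<forall>j<k. digits_of g n ! (i + j) = w ! j)}"
  have "(\<lambda>p. l - k - p) ` ?P \<subseteq> ?O"
  proof (clarify, intro conjI allI impI)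
    fix p assume p: "p + k \<le> l" "n div g ^ p mod g ^ k = word_value g w"
    show "l - k - p + k \<le> l" using p by simp
    fix j assume j: "j < k"
    define t where "t = k - 1 - j"
    have t: "t < k" "j = k - 1 - t" using j by (auto simp: t_def)
    have digit: "a mod g ^ k div g ^ t mod g = a div g ^ t mod g" for a
    proof -
      have "g ^ k = g ^ t * g ^ (k - t)" and "g dvd g ^ (k - t)"
        using t by (auto simp flip: power_add intro: dvd_power)
      then show ?thesis using assms(1)
        by (simp add: mod_mult2_eq mod_mod_cancel)
    qed
    have "w ! j = n div g ^ (p + t) mod g"
      using word_value_digit[OF assms(1,3), of t] t p(2) digit[of "n div g ^ p"]
      by (simp add: k_def power_add div_mult2_eq)
    also have "\<dots> = digits_of g n ! (l - 1 - (p + t))"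
      using p(1) t by (subst nth_digits_of[OF assms(1), symmetric]) (auto simp: l_def)
    also have "l - 1 - (p + t) = l - k - p + j" using p(1) j by (simp add: t_def)
    finally show "digits_of g n ! (l - k - p + j) = w ! j" ..
  qed
  then have "card ((\<lambda>p. l - k - p) ` ?P) \<le> card ?O"
    by (intro card_mono) (auto simp: l_def k_def)
  moreover have "inj_on (\<lambda>p. l - k - p) ?P" by (auto simp: inj_on_def)
  ultimately show ?thesis by (simp add: card_image occurrences_def l_def k_def)
qed

text \<open>Moment generating function of a digit count: for uniform m < Q^M the digits are
  independent, and each contributes z for the digit \<open>W\<close> and 1 for each of the other Q -
  1 digits.\<close>

lemma sum_power_digit_count:
  fixes z :: real
  assumes "Q > 0" "W < Q"
  shows "(\<Sum>m<Q ^ M. z ^ card {i. i < M \<and> (m div Q ^ i) mod Q = W}) = (real Q - 1 + z) ^ M"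
proof (induction M)
  case (Suc M)
  let ?c = "\<lambda>M m. card {i. i < M \<and> (m div Q ^ i) mod Q = W}"
  have c: "?c (Suc M) (m * Q + d) = of_bool (d = W) + ?c M m" if "d < Q" for m d
  proof -
    have "{i. i < Suc M \<and> ((m * Q + d) div Q ^ i) mod Q = W}
        = (if d = W then {0} else {}) \<union> Suc ` {i. i < M \<and> (m div Q ^ i) mod Q = W}"
      (is "?L = ?R")
    proof (rule Set.set_eqI)
      fix i show "i \<in> ?L \<longleftrightarrow> i \<in> ?R"
        by (cases i) (use that in \<open>auto simp: div_mult2_eq\<close>)
    qed
    then show ?thesis
      by (simp add: card_image)
  qed
  have "(\<Sum>m<Q ^ Suc M. z ^ ?c (Suc M) m) = (\<Sum>m<Q ^ M. \<Sum>j=m*Q..<m*Q+Q. z ^ ?c (Suc M) j)"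
    by (subst sum.nat_group) (simp add: mult.commute)
  also have "\<dots> = (\<Sum>m<Q ^ M. \<Sum>d<Q. z ^ ?c (Suc M) (m * Q + d))"
  proof (rule sum.cong[OF refl])
    fix m show "(\<Sum>j=m*Q..<m*Q+Q. z ^ ?c (Suc M) j) = (\<Sum>d<Q. z ^ ?c (Suc M) (m * Q + d))"
      using sum.shift_bounds_nat_ivl[of "\<lambda>j. z ^ ?c (Suc M) j" 0 "m * Q" Q]
      by (simp add: add.commute lessThan_atLeast0)
  qed
  also have "\<dots> = (\<Sum>m<Q ^ M. \<Sum>d<Q. (if d = W then z else 1) * z ^ ?c M m)"
    by (intro sum.cong refl) (auto simp: c)
  also have "\<dots> = (\<Sum>m<Q ^ M. (real Q - 1 + z) * z ^ ?c M m)"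
  proof (intro sum.cong refl)
    fix m
    have "(\<Sum>d<Q. if d = W then z else 1) = real Q - 1 + z"
      using assms by (simp add: sum.remove[of "{..<Q}" W] of_nat_diff)
    then show "(\<Sum>d<Q. (if d = W then z else 1) * z ^ ?c M m) = (real Q - 1 + z) * z ^ ?c M m"
      by (simp flip: sum_distrib_right)
  qed
  also have "\<dots> = (real Q - 1 + z) ^ Suc M"
    using Suc.IH by (simp flip: sum_distrib_left)
  finally show ?case .
qed simp

text \<open>Chernoff's method with tilt z = exp (-\<epsilon>), the tilt being equal to the
  deviation. This choice is not optimal, but it gives an exponent independent of
  \<open>Q\<close>.\<close>

lemma digit_count_lower_tail:
  fixes \<epsilon> :: real
  assumes "Q > 0" "W < Q" "\<epsilon> > 0"
  shows "real (card {m. m < Q ^ M \<and>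
            real (card {i. i < M \<and> (m div Q ^ i) mod Q = W}) \<le> (1 / real Q - \<epsilon>) * real M})
         \<le> real Q ^ M * exp (- (\<epsilon>\<^sup>2 / 2) * real M)"
proof -
  let ?c = "\<lambda>m. card {i. i < M \<and> (m div Q ^ i) mod Q = W}"
  define \<theta> where "\<theta> = 1 / real Q - \<epsilon>"
  define B where "B = {m. m < Q ^ M \<and> real (?c m) \<le> \<theta> * real M}"
  have Q: "real Q \<ge> 1" using assms by linarith
  have "real (card B) = (\<Sum>m\<in>B. 1)" by simp
  \<comment> \<open>Markov's inequality: the weight is at least 1 on \<open>B\<close>, and
    afterwards the sum is extended to all m.\<close>
  also have "\<dots> \<le> (\<Sum>m\<in>B. exp (\<epsilon> * \<theta> * real M) * exp (-\<epsilon>) ^ ?c m)"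
  proof (rule sum_mono)
    fix m assume "m \<in> B"
    then have "\<epsilon> * real (?c m) \<le> \<epsilon> * (\<theta> * real M)"
      using assms(3) by (intro mult_left_mono) (auto simp: B_def)
    then show "1 \<le> exp (\<epsilon> * \<theta> * real M) * exp (-\<epsilon>) ^ ?c m"
      by (simp add: exp_of_nat_mult[symmetric] exp_add[symmetric] algebra_simps)
  qed
  also have "\<dots> \<le> (\<Sum>m<Q ^ M. exp (\<epsilon> * \<theta> * real M) * exp (-\<epsilon>) ^ ?c m)"
    by (intro sum_mono2) (auto simp: B_def)
  also have "\<dots> = exp (\<epsilon> * \<theta> * real M) * (real Q - 1 + exp (-\<epsilon>)) ^ M"
    by (simp add: sum_power_digit_count[OF assms(1,2)] flip: sum_distrib_left)
  also have "\<dots> \<le> exp (\<epsilon> * \<theta> * real M) * (real Q * exp (- (\<epsilon> - \<epsilon>\<^sup>2 / 2) / real Q)) ^ M"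
  proof (intro mult_left_mono power_mono)
    \<comment> \<open>Obtained from the lower Taylor bound for exp \<epsilon>, because (1 +
      \<epsilon> + \<epsilon>^2/2) (1 - \<epsilon> + \<epsilon>^2/2) = 1 + \<epsilon>^4/4 is at
      least 1.\<close>
    have "exp (-\<epsilon>) \<le> 1 - \<epsilon> + \<epsilon>\<^sup>2 / 2"
    proof -
      have "1 / (1 + \<epsilon> + \<epsilon>\<^sup>2 / 2) \<le> 1 - \<epsilon> + \<epsilon>\<^sup>2 / 2"
      proof -
        have "(1 + \<epsilon> + \<epsilon>\<^sup>2 / 2) * (1 - \<epsilon> + \<epsilon>\<^sup>2 / 2) = 1 + (\<epsilon>\<^sup>2 / 2)\<^sup>2"
          by (simp add: power2_eq_square field_simps)
        then have "1 \<le> (1 - \<epsilon> + \<epsilon>\<^sup>2 / 2) * (1 + \<epsilon> + \<epsilon>\<^sup>2 / 2)"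
          by (simp add: mult.commute)
        then show ?thesis using assms(3) by (subst pos_divide_le_eq) (auto simp: add_pos_pos)
      qed
      moreover have "exp (-\<epsilon>) \<le> 1 / (1 + \<epsilon> + \<epsilon>\<^sup>2 / 2)"
        using exp_lower_Taylor_quadratic[of \<epsilon>] assms(3)
        by (simp add: exp_minus field_simps add_pos_pos)
      ultimately show ?thesis by linarith
    qed
    then have "real Q - 1 + exp (-\<epsilon>) \<le> real Q - (\<epsilon> - \<epsilon>\<^sup>2 / 2)"
      by simp
    also have "\<dots> = real Q * (1 + (- (\<epsilon> - \<epsilon>\<^sup>2 / 2) / real Q))"
      using Q by (simp add: distrib_left)
    also have "\<dots> \<le> real Q * exp (- (\<epsilon> - \<epsilon>\<^sup>2 / 2) / real Q)"
      using Q exp_ge_add_one_self[of "- (\<epsilon> - \<epsilon>\<^sup>2 / 2) / real Q"] by (intro mult_left_mono) auto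
    finally show "real Q - 1 + exp (-\<epsilon>) \<le> \<dots>" .
    show "0 \<le> real Q - 1 + exp (-\<epsilon>)" using Q by (simp add: add_nonneg_nonneg)
  qed auto
  \<comment> \<open>Since \<theta> = 1/Q - \<epsilon>, the terms \<epsilon>/Q cancel in the
    exponent.\<close>
  also have "\<dots> = real Q ^ M * exp ((\<epsilon>\<^sup>2 / 2 / real Q - \<epsilon>\<^sup>2) * real M)"
    using Q by (simp add: power_mult_distrib exp_of_nat_mult[symmetric] exp_add[symmetric]
        \<theta>_def field_simps power2_eq_square)
  also have "\<dots> \<le> real Q ^ M * exp (- (\<epsilon>\<^sup>2 / 2) * real M)"
  proof -
    have "\<epsilon>\<^sup>2 / 2 / real Q \<le> \<epsilon>\<^sup>2 / 2" using Q by (simp add: field_simps mult_le_cancel_right1)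
    then have "(\<epsilon>\<^sup>2 / 2 / real Q - \<epsilon>\<^sup>2) * real M \<le> - (\<epsilon>\<^sup>2 / 2) * real M"
      by (intro mult_right_mono) auto
    then show ?thesis by (intro mult_left_mono) auto
  qed
  finally show ?thesis by (simp add: B_def \<theta>_def)
qed

text \<open>A number is written as \<open>a + g\<^sup>j b + g\<^bsup>j+kM\<^esup> c\<close>, and only the middle part \<open>b\<close> is constrained.\<close>

lemma shifted_digit_count_lower_tail:
  fixes \<epsilon> :: real
  assumes "g \<ge> 2" "k > 0" "W < g ^ k" "\<epsilon> > 0" "j + k * M \<le> l"
  shows "real (card {m. m < g ^ l \<and>
            real (card {i. i < M \<and> (m div g ^ (j + k * i)) mod g ^ k = W})
              \<le> (1 / real (g ^ k) - \<epsilon>) * real M})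
         \<le> real g ^ l * exp (- (\<epsilon>\<^sup>2 / 2) * real M)"
proof -
  let ?Q = "g ^ k"
  let ?c = "\<lambda>m. card {i. i < M \<and> (m div ?Q ^ i) mod ?Q = W}"
  define \<theta> where "\<theta> = 1 / real ?Q - \<epsilon>"
  define B where "B = {m. m < ?Q ^ M \<and> real (?c m) \<le> \<theta> * real M}"
  define A where "A = {m. m < g ^ l \<and>
            real (card {i. i < M \<and> (m div g ^ (j + k * i)) mod ?Q = W}) \<le> \<theta> * real M}"
  define r where "r = l - (j + k * M)"
  define h where "h = (\<lambda>m. (m mod g ^ j, (m div g ^ j) mod ?Q ^ M, m div g ^ j div ?Q ^ M))"
  have "inj_on h A"
    unfolding h_def
  proof (rule inj_onI, clarify)
    fix m m' assume *: "m mod g ^ j = m' mod g ^ j" "m div g ^ j mod ?Q ^ M = m' div g ^ j mod ?Q ^ M"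
      "m div g ^ j div ?Q ^ M = m' div g ^ j div ?Q ^ M"
    have "m div g ^ j = m' div g ^ j" by (metis *(2,3) div_mult_mod_eq)
    then show "m = m'" by (metis *(1) div_mult_mod_eq)
  qed
  moreover have "h ` A \<subseteq> {..<g ^ j} \<times> B \<times> {..<g ^ r}"
  proof (rule image_subsetI)
    fix m assume m: "m \<in> A"
    define b where "b = (m div g ^ j) mod ?Q ^ M"
    have "(m div g ^ (j + k * i)) mod ?Q = (b div ?Q ^ i) mod ?Q" if "i < M" for i
    proof -
      have "?Q ^ M = ?Q ^ i * ?Q ^ (M - i)" and "?Q dvd ?Q ^ (M - i)"
        using that by (auto simp flip: power_add intro: dvd_power)
      then have "b div ?Q ^ i mod ?Q = m div g ^ j div ?Q ^ i mod ?Q"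
        unfolding b_def using assms(1) by (simp add: mod_mult2_eq mod_mod_cancel)
      then show ?thesis by (simp add: power_add power_mult div_mult2_eq)
    qed
    then have "{i. i < M \<and> (m div g ^ (j + k * i)) mod ?Q = W} = {i. i < M \<and> (b div ?Q ^ i) mod ?Q = W}"
      by auto
    then have "b \<in> B" using m assms(1) by (simp add: A_def B_def b_def)
    moreover have "m div g ^ j div ?Q ^ M < g ^ r"
    proof -
      have "g ^ l = g ^ r * (g ^ j * ?Q ^ M)"
        using assms(5) by (simp add: r_def flip: power_mult power_add)
      then have "m < g ^ r * (g ^ j * ?Q ^ M)" using m by (simp add: A_def)
      then show ?thesis using assms(1)
        by (simp add: div_less_iff_less_mult flip: div_mult2_eq)
    qed
    ultimately show "h m \<in> {..<g ^ j} \<times> B \<times> {..<g ^ r}"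
      using assms(1) by (simp add: h_def b_def)
  qed
  moreover have "finite B" by (simp add: B_def)
  ultimately have "card A \<le> card ({..<g ^ j} \<times> B \<times> {..<g ^ r})"
    by (intro card_inj_on_le[of h]) auto
  also have "\<dots> = g ^ j * (card B * g ^ r)" by (simp add: card_cartesian_product)
  finally have "real (card A) \<le> real g ^ j * (real (card B) * real g ^ r)"
    using of_nat_mono[where 'a=real] by fastforce
  also have "\<dots> \<le> real g ^ j * ((real ?Q ^ M * exp (- (\<epsilon>\<^sup>2 / 2) * real M)) * real g ^ r)"
    using digit_count_lower_tail[of ?Q W \<epsilon> M] assms
    by (intro mult_left_mono mult_right_mono) (auto simp: B_def \<theta>_def)
  also have "\<dots> = real g ^ l * exp (- (\<epsilon>\<^sup>2 / 2) * real M)"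
  proof -
    have "real g ^ l = real g ^ j * real g ^ (k * M) * real g ^ r"
      using assms(5) by (simp add: r_def flip: power_add)
    then show ?thesis by (simp add: power_mult)
  qed
  finally show ?thesis by (simp add: A_def \<theta>_def)
qed

text \<open>Overlapping windows are not independent, so their positions are split by residue modulo
  \<open>k\<close>. Within one residue class \<open>j\<close> the windows are disjoint and are the
  digits in base g^k of a shifted number. If the total count is small, some class has a small count.
  The term 2k pays for the ends: each class has at least l/k - 2 windows.\<close>

lemma sparse_word_count:
  fixes \<epsilon> :: real
  assumes "g \<ge> 2" "k > 0" "W < g ^ k" "\<epsilon> > 0"
  shows "real (card {m. m < g ^ l \<and>
            real (card {p. p + k \<le> l \<and> (m div g ^ p) mod g ^ k = W})
              \<le> (1 / real (g ^ k) - \<epsilon>) * real l - 2 * real k})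
         \<le> real k * exp (\<epsilon>\<^sup>2) * (real g * exp (- (\<epsilon>\<^sup>2 / 2) / real k)) ^ l"
proof -
  define \<theta> where "\<theta> = 1 / real (g ^ k) - \<epsilon>"
  define M where "M = (\<lambda>j. (l - j) div k)"
  let ?occ = "\<lambda>m. card {p. p + k \<le> l \<and> (m div g ^ p) mod g ^ k = W}"
  let ?C = "\<lambda>m j. {i. i < M j \<and> (m div g ^ (j + k * i)) mod g ^ k = W}"
  define A where "A = (\<lambda>j. {m. m < g ^ l \<and> real (card (?C m j)) \<le> \<theta> * real (M j)})"
  define S where "S = {m. m < g ^ l \<and> real (?occ m) \<le> \<theta> * real l - 2 * real k}"
  have "1 / real (g ^ k) \<le> 1" using assms by (simp add: field_simps)
  then have \<theta>1: "\<theta> \<le> 1" using assms(4) by (simp add: \<theta>_def)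
  have Mge: "real (M j) \<ge> real l / real k - 2" if "j < k" for j
  proof -
    have "l - j < k * (M j + 1)"
      unfolding M_def using assms(2) by (simp add: dividend_less_times_div mult.commute)
    then have "l < k * (M j + 2)" using that by (simp add: algebra_simps)
    then have "real l \<le> real k * (real (M j) + 2)"
      by (metis less_imp_le of_nat_add of_nat_le_iff of_nat_mult of_nat_numeral)
    then show ?thesis using assms(2) by (simp add: field_simps)
  qed
  have Mle: "j + k * M j \<le> l" if "j < k" "M j > 0" for j
  proof -
    have "k * M j \<le> l - j" by (simp add: M_def)
    moreover have "j \<le> l" using that(2)
      by (cases "j \<le> l") (auto simp: M_def)
    ultimately show ?thesis by simp
  qed
  \<comment> \<open>The condition \<open>M j > 0\<close> guarantees j \<le> l; otherwise truncated
    subtraction would hide a shift beyond the last digit.\<close>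
  have "S \<subseteq> (\<Union>j\<in>{j. j < k \<and> M j > 0}. A j)"
  proof
    fix m assume m: "m \<in> S"
    \<comment> \<open>A count is nonnegative, so a single member of \<open>S\<close> forces \<theta>
      l \<ge> 2k. Hence \<theta> \<ge> 0, l \<ge> 2k, and every residue class contains a
      window.\<close>
    then have "real (?occ m) \<ge> 0" and pos: "\<theta> * real l - 2 * real k \<ge> 0" by (auto simp: S_def)
    have lk: "real l \<ge> 2 * real k"
      using pos \<theta>1 mult_right_mono[OF \<theta>1, of "real l"] by linarith
    have Mpos: "M j > 0" if "j < k" for j
      using lk that assms(2) unfolding M_def by (simp add: div_greater_zero_iff)
    have \<theta>0: "\<theta> \<ge> 0"
    proof (rule ccontr)
      assume "\<not> ?thesis"
      then have "\<theta> * real l \<le> 0" by (simp add: mult_nonpos_nonneg)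
      then show False using pos assms(2) by simp
    qed
    have "\<exists>j<k. m \<in> A j"
    proof (rule ccontr)
      assume "\<not> ?thesis"
      then have nA: "real (card (?C m j)) > \<theta> * real (M j)" if "j < k" for j
        using that m by (auto simp: A_def S_def not_le)
      let ?h = "\<lambda>(j, i). j + k * i"
      have "(\<Sum>j<k. card (?C m j)) = card (SIGMA j:{..<k}. ?C m j)"
        by (subst card_SigmaI) auto
      also have "\<dots> = card (?h ` (SIGMA j:{..<k}. ?C m j))"
      proof (rule card_image[symmetric], rule inj_onI)
        fix a b assume ab: "a \<in> (SIGMA j:{..<k}. ?C m j)" "b \<in> (SIGMA j:{..<k}. ?C m j)" "?h a = ?h b"
        have eq: "fst a + k * snd a = fst b + k * snd b" using ab(3) by (simp only: case_prod_unfold)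
        have lt: "fst a < k" "fst b < k" using ab(1,2) by (auto simp del: mem_Collect_eq)
        from eq have "(fst a + k * snd a) mod k = (fst b + k * snd b) mod k" by (rule arg_cong)
        moreover from eq have "(fst a + k * snd a) div k = (fst b + k * snd b) div k" by (rule arg_cong)
        ultimately show "a = b" using lt by (simp add: prod_eq_iff)
      qed
      also have "\<dots> \<le> ?occ m"
      proof (intro card_mono)
        show "finite {p. p + k \<le> l \<and> (m div g ^ p) mod g ^ k = W}"
          by (rule finite_subset[of _ "{..l}"]) auto
        show "?h ` (SIGMA j:{..<k}. ?C m j) \<subseteq> {p. p + k \<le> l \<and> (m div g ^ p) mod g ^ k = W}"
        proof clarsimp
          fix j i assume ji: "j < k" "i < M j"
          have "k * Suc i \<le> k * M j" using ji by (intro mult_le_mono) auto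
          then show "j + k * i + k \<le> l" using Mle[of j] ji by simp
        qed
      qed
      finally have "(\<Sum>j<k. real (card (?C m j))) \<le> real (?occ m)"
        by (simp only: of_nat_le_iff flip: of_nat_sum)
      moreover have "(\<Sum>j<k. \<theta> * (real l / real k - 2)) < (\<Sum>j<k. real (card (?C m j)))"
      proof (rule sum_strict_mono)
        fix j assume "j \<in> {..<k}"
        then show "\<theta> * (real l / real k - 2) < real (card (?C m j))"
          using mult_left_mono[OF Mge \<theta>0, of j] nA[of j] by auto
      qed (use assms(2) in auto)
      moreover have "(\<Sum>j<k. \<theta> * (real l / real k - 2)) = \<theta> * real l - 2 * \<theta> * real k"
        using assms(2) by (simp add: field_simps)
      moreover have "2 * \<theta> * real k \<le> 2 * real k" using mult_right_mono[OF \<theta>1, of "real k"] by simp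
      ultimately show False using m by (simp add: S_def)
    qed
    then show "m \<in> (\<Union>j\<in>{j. j < k \<and> M j > 0}. A j)" using Mpos by auto
  qed
  then have "card S \<le> card (\<Union>j\<in>{j. j < k \<and> M j > 0}. A j)"
    by (intro card_mono) (auto simp: A_def)
  also have "\<dots> \<le> (\<Sum>j\<in>{j. j < k \<and> M j > 0}. card (A j))"
    by (intro card_UN_le) simp
  finally have "real (card S) \<le> (\<Sum>j\<in>{j. j < k \<and> M j > 0}. real (card (A j)))"
    by (simp only: of_nat_le_iff flip: of_nat_sum)
  also have "\<dots> \<le> (\<Sum>j\<in>{j. j < k \<and> M j > 0}. real g ^ l * exp (- (\<epsilon>\<^sup>2 / 2) * (real l / real k - 2)))"
  proof (rule sum_mono)
    fix j assume j: "j \<in> {j. j < k \<and> M j > 0}"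
    have "real (card (A j)) \<le> real g ^ l * exp (- (\<epsilon>\<^sup>2 / 2) * real (M j))"
      unfolding A_def \<theta>_def using assms j by (intro shifted_digit_count_lower_tail Mle) auto
    also have "\<dots> \<le> real g ^ l * exp (- (\<epsilon>\<^sup>2 / 2) * (real l / real k - 2))"
      using Mge[of j] j by (intro mult_left_mono) (auto intro!: mult_left_mono)
    finally show "real (card (A j)) \<le> \<dots>" .
  qed
  also have "\<dots> \<le> (\<Sum>j<k. real g ^ l * exp (- (\<epsilon>\<^sup>2 / 2) * (real l / real k - 2)))"
    by (intro sum_mono2) auto
  also have "\<dots> = real k * exp (\<epsilon>\<^sup>2) * (real g * exp (- (\<epsilon>\<^sup>2 / 2) / real k)) ^ l"
  proof -
    have "exp (- (\<epsilon>\<^sup>2 / 2) * (real l / real k - 2)) = exp (\<epsilon>\<^sup>2) * exp (- (\<epsilon>\<^sup>2 / 2) / real k) ^ l"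
    proof -
      have "- (\<epsilon>\<^sup>2 / 2) * (real l / real k - 2) = \<epsilon>\<^sup>2 + real l * (- (\<epsilon>\<^sup>2 / 2) / real k)"
        using assms(2) by (simp add: field_simps)
      then show ?thesis by (simp only: exp_add exp_of_nat_mult)
    qed
    then show ?thesis by (simp add: power_mult_distrib)
  qed
  finally show ?thesis by (simp add: S_def \<theta>_def)
qed

section \<open>Normality of concatenations\<close>

text \<open>The tails \<open>R n\<close> satisfy g R(n) = d(n) + R(n+1) and lie in [0,1), so the
  floor reads off the digits. Strictness R(n) < 1 is exactly where a constant tail of digits g - 1
  must be excluded.\<close>

lemma real_digit_suminf:
  fixes d :: "nat \<Rightarrow> nat"
  assumes g: "g \<ge> 2" and d: "\<And>i. d i < g" and tail: "\<And>n. \<exists>i\<ge>n. d i \<noteq> g - 1"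
  shows "real_digit g (\<Sum>i. real (d i) / real g ^ Suc i) i = d i"
proof -
  define R where "R = (\<lambda>n. \<Sum>i. real (d (i + n)) / real g ^ Suc i)"
  have geo: "(\<lambda>i. real (g - 1) / real g ^ Suc i) sums 1"
  proof -
    have "(\<lambda>i. (real (g - 1) / real g) * (1 / real g) ^ i) sums ((real (g - 1) / real g) * (1 / (1 - 1 / real g)))"
      using g by (intro sums_mult geometric_sums) auto
    also have "(real (g - 1) / real g) * (1 / (1 - 1 / real g)) = 1"
      using g by (simp add: field_simps of_nat_diff)
    finally show ?thesis by (simp add: power_one_over)
  qed
  have sm: "summable (\<lambda>i. real (d (i + n)) / real g ^ Suc i)" for n
  proof (rule summable_comparison_test'[OF sums_summable[OF geo], of 0])
    fix i :: nat
    have "d (i + n) \<le> g - 1" using d[of "i + n"] by simp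
    then show "norm (real (d (i + n)) / real g ^ Suc i) \<le> real (g - 1) / real g ^ Suc i"
      by (simp add: divide_right_mono)
  qed
  have R0: "R n \<ge> 0" for n unfolding R_def by (intro suminf_nonneg sm) auto
  have R1: "R n < 1" for n
  proof -
    obtain i where i: "i \<ge> n" "d i \<noteq> g - 1" using tail by blast
    have le: "d j \<le> g - 1" for j using d[of j] by simp
    have "0 < (\<Sum>i. real (g - 1) / real g ^ Suc i - real (d (i + n)) / real g ^ Suc i)"
    proof (rule suminf_pos2[where i = "i - n"])
      show "0 \<le> real (g - 1) / real g ^ Suc i - real (d (i + n)) / real g ^ Suc i" for i
        using le[of "i + n"] by (simp add: divide_right_mono)
      have "d i < g - 1" using le[of i] i by simp
      then show "0 < real (g - 1) / real g ^ Suc (i - n) - real (d (i - n + n)) / real g ^ Suc (i - n)"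
        using i g by (simp add: divide_strict_right_mono)
    qed (intro summable_diff sm sums_summable[OF geo])
    also have "\<dots> = 1 - R n"
      using suminf_diff[OF sums_summable[OF geo] sm[of n]] sums_unique[OF geo] by (simp only: R_def)
    finally show ?thesis by simp
  qed
  have Rrec: "R n * real g = real (d n) + R (Suc n)" for n
  proof -
    have "R n = (\<Sum>i. real (d (Suc i + n)) / real g ^ Suc (Suc i)) + real (d n) / real g"
      using suminf_split_head[OF sm[of n]] by (simp add: R_def)
    also have "(\<lambda>i. real (d (Suc i + n)) / real g ^ Suc (Suc i)) = (\<lambda>i. real (d (i + Suc n)) / real g ^ Suc i / real g)"
      by (rule ext) (simp add: mult.commute)
    also have "(\<Sum>i. real (d (i + Suc n)) / real g ^ Suc i / real g) = R (Suc n) / real g"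
      unfolding R_def by (rule suminf_divide[OF sm])
    finally show ?thesis using g by (simp add: field_simps)
  qed
  have ex: "\<exists>I::nat. R 0 * real g ^ n = real I + R n" for n
  proof (induction n)
    case (Suc n)
    then obtain I :: nat where "R 0 * real g ^ n = real I + R n" by blast
    then have "R 0 * real g ^ Suc n = real (I * g + d n) + R (Suc n)"
      using Rrec[of n] by (simp add: algebra_simps)
    then show ?case by blast
  qed (auto intro: exI[of _ 0])
  obtain I :: nat where "R 0 * real g ^ i = real I + R i" using ex by blast
  then have "R 0 * real g ^ Suc i = real (I * g + d i) + R (Suc i)"
    using Rrec[of i] by (simp add: algebra_simps)
  then have "\<lfloor>R 0 * real g ^ Suc i\<rfloor> = int (I * g + d i)"
    using R0[of "Suc i"] R1[of "Suc i"] by linarith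
  then have "real_digit g (R 0) i = d i"
    using d[of i] by (simp add: real_digit_def nat_mod_as_int)
  then show ?thesis by (simp add: R_def)
qed

section \<open>Prefixes of the concatenated digit sequence\<close>

definition block_prefix :: "nat \<Rightarrow> (nat \<Rightarrow> nat) \<Rightarrow> nat \<Rightarrow> nat list" where
  "block_prefix g a n = concat (map (\<lambda>k. digits_of g (a k)) [0..<n])"

lemma block_prefix_Suc: "block_prefix g a (Suc n) = block_prefix g a n @ digits_of g (a n)"
  by (simp add: block_prefix_def)

lemma length_block_prefix: "length (block_prefix g a n) = (\<Sum>i<n. length (digits_of g (a i)))"
  by (induction n) (simp_all add: block_prefix_Suc, simp add: block_prefix_def)

lemma length_block_prefix_ge: "n \<le> length (block_prefix g a n)"
proof (induction n)
  case (Suc n)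
  have "length (digits_of g (a n)) \<ge> 1" by (simp add: Suc_le_eq)
  then show ?case using Suc by (simp add: block_prefix_Suc)
qed simp

lemma block_prefix_nth:
  assumes "m \<le> n" "i < length (block_prefix g a m)"
  shows "block_prefix g a n ! i = block_prefix g a m ! i"
  using assms
proof (induction n rule: dec_induct)
  case (step n)
  have "length (block_prefix g a m) \<le> length (block_prefix g a n)"
    using step.hyps by (auto simp: length_block_prefix intro: sum_mono2)
  then show ?case using step by (simp add: block_prefix_Suc nth_append)
qed simp

lemma concat_digit_eq:
  assumes "i < length (block_prefix g a n)"
  shows "concat_digit g a i = block_prefix g a n ! i"
proof -
  have "i < length (block_prefix g a (Suc i))" using length_block_prefix_ge[of "Suc i" g a] by simp
  then have "block_prefix g a (Suc i) ! i = block_prefix g a n ! i"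
    using block_prefix_nth[of n "Suc i" i g a] block_prefix_nth[of "Suc i" n i g a] assms
    by (metis nat_le_linear)
  then show ?thesis by (simp add: concat_digit_def block_prefix_def)
qed

lemma concat_digit_less: "g \<ge> 2 \<Longrightarrow> concat_digit g a i < g"
proof -
  assume g: "g \<ge> 2"
  have i: "i < length (block_prefix g a (Suc i))" using length_block_prefix_ge[of "Suc i" g a] by simp
  then have "block_prefix g a (Suc i) ! i \<in> set (block_prefix g a (Suc i))" by (rule nth_mem)
  also have "\<dots> \<subseteq> {..<g}" using set_digits_of[OF g] by (auto simp: block_prefix_def)
  finally show ?thesis by (simp add: concat_digit_eq[OF i])
qed

lemma frequency_limit_from_below:
  fixes c :: "nat \<Rightarrow> nat"
  assumes c: "\<And>i. c i < g" and g: "g > 0" and w: "length w = k" "set w \<subseteq> {..<g}"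
    and low: "\<And>v \<epsilon>. length v = k \<Longrightarrow> set v \<subseteq> {..<g} \<Longrightarrow> \<epsilon> > 0 \<Longrightarrow>
      \<forall>\<^sub>F N in sequentially. (1 / real g ^ k - \<epsilon>) * real N
        \<le> real (card {i. i < N \<and> (\<forall>j<k. c (i + j) = v ! j)})"
  shows "(\<lambda>N. real (card {i. i < N \<and> (\<forall>j<k. c (i + j) = w ! j)}) / real N)
    \<longlonglongrightarrow> 1 / real g ^ k"
proof (rule tendstoI)
  fix e :: real assume e: "e > 0"
  define Q where "Q = real g ^ k"
  have Q: "Q \<ge> 1" using g by (simp add: Q_def)
  \<comment> \<open>The upper deviation for \<open>w\<close> collects the lower deviations of the
    other Q - 1 words, hence the division by \<open>Q\<close>.\<close>
  define \<epsilon> where "\<epsilon> = e / (2 * Q)"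
  have \<epsilon>: "\<epsilon> > 0" "\<epsilon> < e" "Q * \<epsilon> < e" using e Q by (auto simp: \<epsilon>_def field_simps)
  define W where "W = {v. set v \<subseteq> {..<g} \<and> length v = k}"
  have finW: "finite W" and cardW: "real (card W) = Q"
    unfolding W_def Q_def by (simp_all add: finite_lists_length_eq card_lists_length_eq)
  let ?n = "\<lambda>v N. card {i. i < N \<and> (\<forall>j<k. c (i + j) = v ! j)}"
  have total: "(\<Sum>v\<in>W. ?n v N) = N" for N
  proof -
    have "(\<Sum>v\<in>W. ?n v N) = card (\<Union>v\<in>W. {i. i < N \<and> (\<forall>j<k. c (i + j) = v ! j)})"
    proof (rule card_UN_disjoint[symmetric, OF finW])
      show "\<forall>u\<in>W. \<forall>v\<in>W. u \<noteq> v \<longrightarrow>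
        {i. i < N \<and> (\<forall>j<k. c (i + j) = u ! j)} \<inter> {i. i < N \<and> (\<forall>j<k. c (i + j) = v ! j)} = {}"
        by (auto simp: W_def list_eq_iff_nth_eq)
    qed auto
    also have "(\<Union>v\<in>W. {i. i < N \<and> (\<forall>j<k. c (i + j) = v ! j)}) = {..<N}"
    proof (intro equalityI subsetI)
      fix i assume "i \<in> {..<N}"
      moreover have "map (\<lambda>j. c (i + j)) [0..<k] \<in> W" using c by (auto simp: W_def)
      ultimately show "i \<in> (\<Union>v\<in>W. {i. i < N \<and> (\<forall>j<k. c (i + j) = v ! j)})"
        by (intro UN_I) auto
    qed auto
    finally show ?thesis by simp
  qed
  have wW: "w \<in> W" using w by (simp add: W_def)
  have "\<forall>\<^sub>F N in sequentially. \<forall>v\<in>W. (1 / Q - \<epsilon>) * real N \<le> real (?n v N)"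
    using low \<epsilon>(1) by (intro eventually_ball_finite finW ballI) (auto simp: W_def Q_def)
  then show "\<forall>\<^sub>F N in sequentially. dist (real (?n w N) / real N) (1 / real g ^ k) < e"
    using eventually_gt_at_top[of 0]
  proof eventually_elim
    case (elim N)
    have "real N = real (\<Sum>v\<in>W. ?n v N)" by (simp only: total)
    also have "\<dots> = (\<Sum>v\<in>W - {w}. real (?n v N)) + real (?n w N)"
      by (simp add: sum.remove[OF finW wW])
    finally have "real (?n w N) = real N - (\<Sum>v\<in>W - {w}. real (?n v N))" by simp
    also have "\<dots> \<le> real N - (\<Sum>v\<in>W - {w}. (1 / Q - \<epsilon>) * real N)"
      using elim by (intro diff_left_mono sum_mono) auto
    also have "\<dots> = real N - (Q - 1) * ((1 / Q - \<epsilon>) * real N)"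
      using finW wW by (simp add: cardW[symmetric] card_Diff_singleton of_nat_diff Suc_le_eq card_gt_0_iff ex_in_conv[symmetric] exI[of _ w])
    also have "\<dots> = (1 / Q + (Q - 1) * \<epsilon>) * real N"
      using Q by (simp add: field_simps)
    also have "\<dots> \<le> (1 / Q + Q * \<epsilon>) * real N"
      using \<epsilon> by (intro mult_right_mono) (auto simp: algebra_simps)
    finally have up: "real (?n w N) / real N \<le> 1 / Q + Q * \<epsilon>" using elim by (simp add: pos_divide_le_eq)
    have lo: "1 / Q - \<epsilon> \<le> real (?n w N) / real N" using elim wW by (simp add: pos_le_divide_eq)
    show ?case using up lo \<epsilon> by (simp add: dist_real_def Q_def abs_less_iff) 
  qed
qed

text \<open>Blocks with too few occurrences are measured by their digits, not by their number, since
  block lengths vary. The length of block \<open>n\<close> is added because a position may fall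
  inside an unfinished block, which must be short compared with everything before it.\<close>

theorem normal_concat_real:
  assumes g: "g \<ge> 2"
    and blocks: "\<And>w \<epsilon>. w \<noteq> [] \<Longrightarrow> set w \<subseteq> {..<g} \<Longrightarrow> \<epsilon> > 0 \<Longrightarrow> \<forall>\<^sub>F n in sequentially.
      (\<Sum>i | i < n \<and> real (occurrences w (digits_of g (a i)))
            < (1 / real g ^ length w - \<epsilon>) * real (length (digits_of g (a i))).
          real (length (digits_of g (a i)))) + real (length (digits_of g (a n)))
        \<le> \<epsilon> * (\<Sum>i<n. real (length (digits_of g (a i))))"
  shows "normal_in_base g (concat_real g a)"
proof -
  let ?c = "concat_digit g a"
  let ?len = "\<lambda>i. real (length (digits_of g (a i)))"
  let ?occ = "\<lambda>w i. real (occurrences w (digits_of g (a i)))"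
  have low: "\<forall>\<^sub>F N in sequentially. (1 / real g ^ length w - \<epsilon>) * real N
        \<le> real (card {i. i < N \<and> (\<forall>j<length w. ?c (i + j) = w ! j)})"
    if w: "w \<noteq> []" "set w \<subseteq> {..<g}" and "\<epsilon> > 0" for w and \<epsilon> :: real
  proof -
    define q where "q = 1 / real g ^ length w"
    have q: "0 < q" "q \<le> 1" using g by (auto simp: q_def field_simps)
    \<comment> \<open>A loss of \<delta> occurs three times: the shortfall inside good blocks, the
      share of the bad blocks and the unfinished block. The other two bounds keep q - \<delta> and 1
      - \<delta> nonnegative.\<close>
    define \<delta> where "\<delta> = min (\<epsilon> / 3) (min q (1/2))"
    have \<delta>: "0 < \<delta>" "3 * \<delta> \<le> \<epsilon>" "\<delta> \<le> q" "\<delta> \<le> 1 / 2" using q \<open>\<epsilon> > 0\<close> by (auto simp: \<delta>_def)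
    obtain n0 where n0: "\<And>n. n \<ge> n0 \<Longrightarrow>
      (\<Sum>i | i < n \<and> ?occ w i < (q - \<delta>) * ?len i. ?len i) + ?len n \<le> \<delta> * (\<Sum>i<n. ?len i)"
      using blocks[OF w \<delta>(1)] unfolding eventually_sequentially q_def by blast
    show ?thesis unfolding eventually_sequentially
    proof (intro exI[of _ "length (block_prefix g a n0)"] allI impI)
      fix N assume N: "length (block_prefix g a n0) \<le> N"
      \<comment> \<open>The least number of blocks covering position \<open>N\<close>; all of them
        except the last end at or before \<open>N\<close>.\<close>
      define m where "m = (LEAST m. N < length (block_prefix g a m))"
      have m: "N < length (block_prefix g a m)"
        unfolding m_def
      proof (rule LeastI)
        show "N < length (block_prefix g a (Suc N))" using length_block_prefix_ge[of "Suc N" g a] by simp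
      qed
      have "m > n0"
      proof (rule ccontr)
        assume "\<not> ?thesis"
        then have "length (block_prefix g a m) \<le> length (block_prefix g a n0)"
          by (auto simp: length_block_prefix intro!: sum_mono2)
        then show False using m N by simp
      qed
      then obtain n where n: "m = Suc n" "n \<ge> n0" by (cases m) auto
      have nN: "length (block_prefix g a n) \<le> N"
        using not_less_Least[of n "\<lambda>m. N < length (block_prefix g a m)"] n by (simp add: m_def[symmetric])
      define S where "S = (\<Sum>i<n. ?len i)"
      have S: "S = real (length (block_prefix g a n))" by (simp add: S_def length_block_prefix)
      define E where "E = {i. i < n \<and> ?occ w i < (q - \<delta>) * ?len i}"
      have hyp: "sum ?len E + ?len n \<le> \<delta> * S"
        using n0[OF n(2)] by (simp add: E_def S_def)
      have sE: "sum ?len E \<ge> 0" by (intro sum_nonneg) auto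
      have NS: "real N \<le> (1 + \<delta>) * S"
      proof -
        have "real N \<le> S + ?len n" using m n(1) S by (simp add: block_prefix_Suc)
        then show ?thesis using hyp sE by (simp add: algebra_simps)
      qed
      have S0: "S \<ge> 0" by (simp add: S)
      have "(q - \<delta>) * (S - \<delta> * S) \<le> (q - \<delta>) * (S - sum ?len E)"
        using hyp \<delta> by (intro mult_left_mono) auto
      also have "S - sum ?len E = sum ?len ({..<n} - E)"
        unfolding S_def by (subst sum_diff) (auto simp: E_def)
      also have "(q - \<delta>) * \<dots> \<le> (\<Sum>i\<in>{..<n} - E. ?occ w i)"
        unfolding sum_distrib_left by (intro sum_mono) (auto simp: E_def)
      also have "\<dots> \<le> (\<Sum>i<n. ?occ w i)"
        by (intro sum_mono2) auto
      also have "\<dots> \<le> real (occurrences w (block_prefix g a n))"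
      proof -
        have "(\<Sum>i<n. occurrences w (digits_of g (a i))) \<le> occurrences w (block_prefix g a n)"
          using occurrences_concat[OF w(1), of "map (\<lambda>k. digits_of g (a k)) [0..<n]"]
          by (simp add: block_prefix_def o_def interv_sum_list_conv_sum_set_nat lessThan_atLeast0)
        then show ?thesis by (simp flip: of_nat_sum)
      qed
      also have "\<dots> \<le> real (card {i. i < N \<and> (\<forall>j<length w. ?c (i + j) = w ! j)})"
        unfolding occurrences_def of_nat_le_iff
      proof (intro card_mono subsetI)
        fix i assume i: "i \<in> {i. i + length w \<le> length (block_prefix g a n) \<and>
                 (\<forall>j<length w. block_prefix g a n ! (i + j) = w ! j)}"
        then have "?c (i + j) = w ! j" if "j < length w" for j
          using that concat_digit_eq[of "i + j" g a n] by simp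
        moreover have "i < N" using i nN w(1) by (auto simp flip: length_greater_0_conv)
        ultimately show "i \<in> {i. i < N \<and> (\<forall>j<length w. ?c (i + j) = w ! j)}" by simp
      qed auto
      finally have cnt: "(q - \<delta>) * (1 - \<delta>) * S \<le> real (card {i. i < N \<and> (\<forall>j<length w. ?c (i + j) = w ! j)})"
        by (simp add: algebra_simps)
      have "(q - \<epsilon>) * real N \<le> (q - 3 * \<delta>) * real N"
        using \<delta> by (intro mult_right_mono) auto
      also have "\<dots> \<le> (q - \<delta>) * (1 - \<delta>) * S"
      proof (cases "q - 3 * \<delta> \<ge> 0")
        case True
        have "(q - 3 * \<delta>) * real N \<le> (q - 3 * \<delta>) * ((1 + \<delta>) * S)"
          using NS True by (rule mult_left_mono)
        also have "\<dots> = ((q - 3 * \<delta>) * (1 + \<delta>)) * S" by simp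
        also have "\<dots> \<le> ((q - \<delta>) * (1 - \<delta>)) * S"
        proof (rule mult_right_mono[OF _ S0])
          have "q * \<delta> \<le> 1 * \<delta>" using q \<delta> by (intro mult_right_mono) auto
          moreover have "(q - \<delta>) * (1 - \<delta>) - (q - 3 * \<delta>) * (1 + \<delta>) = 2 * (\<delta> - q * \<delta>) + 4 * (\<delta> * \<delta>)"
            by (simp add: algebra_simps)
          ultimately have "0 \<le> (q - \<delta>) * (1 - \<delta>) - (q - 3 * \<delta>) * (1 + \<delta>)"
            by simp
          then show "(q - 3 * \<delta>) * (1 + \<delta>) \<le> (q - \<delta>) * (1 - \<delta>)" by simp
        qed
        finally show ?thesis .
      next
        case False
        then have "(q - 3 * \<delta>) * real N \<le> 0" by (simp add: mult_nonpos_nonneg)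
        also have "0 \<le> (q - \<delta>) * (1 - \<delta>) * S" using \<delta> S0 by simp
        finally show ?thesis .
      qed
      also note cnt
      finally show "(1 / real g ^ length w - \<epsilon>) * real N \<le> real (card {i. i < N \<and> (\<forall>j<length w. ?c (i + j) = w ! j)})"
        by (simp add: q_def)
    qed
  qed
  have freq: "(\<lambda>N. real (card {i. i < N \<and> (\<forall>j<length w. ?c (i + j) = w ! j)}) / real N)
      \<longlonglongrightarrow> 1 / real g ^ length w" if "w \<noteq> []" "set w \<subseteq> {..<g}" for w
  proof (rule frequency_limit_from_below[OF concat_digit_less[OF g]])
    fix v :: "nat list" and \<epsilon> :: real
    assume v: "length v = length w" "set v \<subseteq> {..<g}" "\<epsilon> > 0"
    have "v \<noteq> []" using v(1) \<open>w \<noteq> []\<close> by auto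
    from low[OF this v(2,3)] show "\<forall>\<^sub>F N in sequentially. (1 / real g ^ length w - \<epsilon>) * real N
        \<le> real (card {i. i < N \<and> (\<forall>j<length w. ?c (i + j) = v ! j)})"
      by (simp only: v(1))
  qed (use that g in auto)
  \<comment> \<open>The tail condition follows from the frequencies already proved: the digit 0 has
    positive frequency and, as g \<ge> 2, differs from g - 1.\<close>
  have "\<exists>i\<ge>n. ?c i \<noteq> g - 1" for n
  proof (rule ccontr)
    assume "\<not> ?thesis"
    then have eq: "?c i = g - 1" if "i \<ge> n" for i using that by blast
    have "(\<lambda>N. real (card {i. i < N \<and> ?c i = 0}) / real N) \<longlonglongrightarrow> 1 / real g"
      using freq[of "[0]"] g by simp
    moreover have "(\<lambda>N. real (card {i. i < N \<and> ?c i = 0}) / real N) \<longlonglongrightarrow> 0"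
    proof (rule tendsto_sandwich)
      have "card {i. i < N \<and> ?c i = 0} \<le> n" for N
      proof -
        have "{i. i < N \<and> ?c i = 0} \<subseteq> {..<n}"
        proof
          fix i assume "i \<in> {i. i < N \<and> ?c i = 0}"
          then have "?c i \<noteq> g - 1" using g by auto
          then show "i \<in> {..<n}" using eq[of i] by force
        qed
        then show ?thesis using card_mono[of "{..<n}"] by fastforce
      qed
      then show "\<forall>\<^sub>F N in sequentially. real (card {i. i < N \<and> ?c i = 0}) / real N \<le> real n / real N"
        by (intro always_eventually allI) (simp add: divide_right_mono)
      show "\<forall>\<^sub>F N in sequentially. 0 \<le> real (card {i. i < N \<and> ?c i = 0}) / real N" by simp
      show "(\<lambda>N. real n / real N) \<longlonglongrightarrow> 0" by (rule lim_const_over_n)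
    qed simp
    ultimately have "1 / real g = 0" by (rule LIMSEQ_unique)
    then show False using g by simp
  qed
  then have "real_digit g (concat_real g a) i = ?c i" for i
    unfolding concat_real_def using g by (intro real_digit_suminf concat_digit_less)
  then show ?thesis unfolding normal_in_base_def using freq by (auto simp: Suc_le_eq)
qed

section \<open>Integers with many prime factors\<close>

lemma harm_le_ln: "n > 0 \<Longrightarrow> harm n \<le> 1 + ln (real n)"
  using euler_mascheroni_sequence_decreasing[of 1 n] by (simp add: harm_def)

lemma harm_eq_sum: "harm n = (\<Sum>k=1..n. 1 / real k)"
  by (simp add: harm_def divide_inverse)

lemma sum_multiples_le:
  assumes "d > 0"
  shows "(\<Sum>n | n \<in> {1..N} \<and> d dvd n. 1 / real n) \<le> harm N / real d"
proof -
  let ?A = "{n. n \<in> {1..N} \<and> d dvd n}"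
  have "(\<Sum>n\<in>?A. 1 / real n) = (\<Sum>k\<in>(\<lambda>n. n div d) ` ?A. 1 / real k) / real d"
  proof -
    have inj: "inj_on (\<lambda>n. n div d) ?A" by (auto simp: inj_on_def)
    show ?thesis
      unfolding sum.reindex[OF inj] sum_divide_distrib
      using assms by (intro sum.cong) (auto elim!: dvdE)
  qed
  also have "\<dots> \<le> harm N / real d"
    unfolding harm_eq_sum using assms
  proof (intro divide_right_mono sum_mono2)
    show "(\<lambda>n. n div d) ` ?A \<subseteq> {1..N}"
    proof (rule image_subsetI)
      fix n assume "n \<in> ?A"
      then have "d \<le> n" "n \<le> N" by (auto dest: dvd_imp_le)
      moreover from \<open>n \<le> N\<close> have "n div d \<le> N" by (rule order_trans[OF div_le_dividend])
      ultimately show "n div d \<in> {1..N}"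
        using assms by (auto simp: Suc_le_eq div_greater_zero_iff)
    qed
  qed auto
  finally show ?thesis .
qed

text \<open>Telescoping of 1/s^2 \<le> 1/(s-1) - 1/s from a = floor S; the factor 2 comes from S < a
  + 1 \<le> 2a.\<close>

lemma sum_inverse_squares_le:
  assumes "S \<ge> 1"
  shows "(\<Sum>s | s \<in> {1..N} \<and> S < real s. 1 / (real s)\<^sup>2) \<le> 2 / S"
proof -
  define a where "a = nat \<lfloor>S\<rfloor>"
  have a: "a \<ge> 1" "real a \<le> S" "S < real a + 1" using assms by (auto simp: a_def le_nat_iff)
  have "(\<Sum>s=Suc a..N. 1 / (real s)\<^sup>2) \<le> 1 / real a - 1 / real (max a N)"
  proof (induction N)
    case (Suc N)
    show ?case
    proof (cases "a \<le> N")
      case True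
      have N: "real N > 0" using True a by simp
      have "1 / (real (Suc N))\<^sup>2 \<le> 1 / (real N * real (Suc N))"
        using N by (intro divide_left_mono) (auto simp: power2_eq_square)
      also have "\<dots> = 1 / real N - 1 / real (Suc N)" using N by (simp add: field_simps)
      finally have "1 / (real (Suc N))\<^sup>2 \<le> 1 / real N - 1 / real (Suc N)" .
      then show ?thesis using Suc True by (simp add: max_def split: if_splits)
    qed (use a in auto)
  qed (use a in simp)
  moreover have "{s. s \<in> {1..N} \<and> S < real s} \<subseteq> {Suc a..N}" using a by auto
  then have "(\<Sum>s | s \<in> {1..N} \<and> S < real s. 1 / (real s)\<^sup>2) \<le> (\<Sum>s=Suc a..N. 1 / (real s)\<^sup>2)"
    by (intro sum_mono2) auto
  moreover have "1 / real a \<le> 2 / S" using a by (simp add: field_simps)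
  moreover have "1 / real (max a N) \<ge> 0" by simp
  ultimately show ?thesis by linarith
qed

section \<open>Prime factors with multiplicity, and numbers of divisors\<close>

definition Omega :: "nat \<Rightarrow> nat" where
  "Omega n = size (prime_factorization n)"

lemma Omega_mult: "m > 0 \<Longrightarrow> n > 0 \<Longrightarrow> Omega (m * n) = Omega m + Omega n"
  by (simp add: Omega_def prime_factorization_mult)

lemma Omega_1 [simp]: "Omega (Suc 0) = 0"
  by (simp add: Omega_def)

lemma Omega_prime: "prime p \<Longrightarrow> Omega p = 1"
  by (simp add: Omega_def prime_factorization_prime)

lemma Omega_prod: "(\<And>x. x \<in> A \<Longrightarrow> f x > 0) \<Longrightarrow> Omega (prod f A) = (\<Sum>x\<in>A. Omega (f x))"
  by (induction A rule: infinite_finite_induct) (auto simp: Omega_mult prod_pos)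

lemma Omega_dvd_mono: "m dvd n \<Longrightarrow> n > 0 \<Longrightarrow> Omega m \<le> Omega n"
  by (auto simp: Omega_mult elim!: dvdE)

lemma Omega_eq_sum: "Omega n = (\<Sum>p\<in>prime_factors n. multiplicity p n)"
  by (simp add: Omega_def size_multiset_overloaded_eq count_prime_factorization_prime in_prime_factors_imp_prime cong: sum.cong)

lemma multiplicity_le_Omega: "p \<in> prime_factors n \<Longrightarrow> multiplicity p n \<le> Omega n"
  unfolding Omega_eq_sum by (intro member_le_sum) auto

lemma card_prime_factors_le_Omega: "card (prime_factors n) \<le> Omega n"
proof -
  have "card (prime_factors n) = (\<Sum>p\<in>prime_factors n. 1)" by simp
  also have "\<dots> \<le> Omega n"
    unfolding Omega_eq_sum by (intro sum_mono) (auto simp: prime_factors_multiplicity)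
  finally show ?thesis .
qed

lemma prime_factor_induct [case_names zero one mult]:
  fixes n :: nat
  assumes "P 0" "P 1" "\<And>p n. prime p \<Longrightarrow> n > 0 \<Longrightarrow> P n \<Longrightarrow> P (p * n)"
  shows "P n"
proof (induction n rule: less_induct)
  case (less n)
  show ?case
  proof (cases "n \<le> 1")
    case False
    then obtain p where p: "prime p" "p dvd n" using prime_factor_nat[of n] by auto
    then obtain k where k: "n = p * k" by (elim dvdE)
    with False have "k > 0" by (intro Nat.gr0I) auto
    moreover have "k < n" using prime_gt_1_nat[OF p(1)] \<open>k > 0\<close> k by simp
    ultimately show ?thesis using assms(3)[OF p(1)] less.IH k by simp
  qed (use assms in \<open>auto simp: le_Suc_eq\<close>)
qed

lemma two_power_Omega_le: "n > 0 \<Longrightarrow> 2 ^ Omega n \<le> n"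
proof (induction n rule: prime_factor_induct)
  case (mult p n)
  then show ?case using prime_ge_2_nat[of p]
    by (auto simp: Omega_mult Omega_prime prime_gt_0_nat intro!: mult_mono)
qed auto

definition tau :: "nat \<Rightarrow> nat" where
  "tau n = card {d. d dvd n}"

lemma tau_le_two_power_Omega: "n > 0 \<Longrightarrow> tau n \<le> 2 ^ Omega n"
proof (induction n rule: prime_factor_induct)
  case (mult p n)
  have fin: "finite {d. d dvd n}" using mult by (simp add: finite_divisors_nat)
  have "{d. d dvd p * n} \<subseteq> {d. d dvd n} \<union> (*) p ` {d. d dvd n}"
  proof
    fix d assume "d \<in> {d. d dvd p * n}"
    then obtain a b where ab: "d = a * b" "a dvd p" "b dvd n"
      using division_decomp[of d p n] by auto
    then have "a = 1 \<or> a = p" using mult(1) by (simp add: prime_nat_iff)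
    then show "d \<in> {d. d dvd n} \<union> (*) p ` {d. d dvd n}" using ab by auto
  qed
  then have "tau (p * n) \<le> card ({d. d dvd n} \<union> (*) p ` {d. d dvd n})"
    unfolding tau_def using fin by (intro card_mono) auto
  also have "\<dots> \<le> tau n + tau n"
    unfolding tau_def using fin card_image_le[OF fin, of "(*) p"] by (intro order_trans[OF card_Un_le]) auto
  finally show ?case using mult by (simp add: Omega_mult Omega_prime prime_gt_0_nat)
qed (auto simp: tau_def)

text \<open>Each set of prime factors has a squarefree product dividing \<open>n\<close>, and the
  product determines the set.\<close>

lemma two_power_card_prime_factors_le:
  assumes "n > 0"
  shows "2 ^ card (prime_factors n) \<le> tau n"
proof -
  have "(2::nat) ^ card (prime_factors n) = card (Pow (prime_factors n))"
    by (simp add: card_Pow)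
  also have "\<dots> \<le> card {d. d dvd n}"
  proof (rule card_inj_on_le)
    have fin: "finite A" if "A \<in> Pow (prime_factors n)" for A
      using that finite_subset by auto
    have pf: "prime_factors (\<Prod>A) = A" if "A \<in> Pow (prime_factors n)" for A
    proof -
      have A: "prime p" if "p \<in> A" for p using \<open>A \<in> _\<close> that by auto
      have "prime_factors (\<Prod>A) = (\<Union>p\<in>A. prime_factors p)"
        using A[of 0] by (subst prime_factors_prod[OF fin[OF that]]) auto
      also have "\<dots> = A" using A by (auto simp: prime_factorization_prime)
      finally show ?thesis .
    qed
    then show "inj_on (\<lambda>A. \<Prod>A) (Pow (prime_factors n))" by (rule inj_on_inverseI)
    show "(\<lambda>A. \<Prod>A) ` Pow (prime_factors n) \<subseteq> {d. d dvd n}"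
    proof clarify
      fix A assume A: "A \<subseteq> prime_factors n"
      have "\<Prod>A dvd \<Prod>(prime_factors n)" using A by (intro prod_dvd_prod_subset) auto
      also have "\<dots> dvd (\<Prod>p\<in>prime_factors n. p ^ multiplicity p n)"
        by (intro prod_dvd_prod) (auto simp: prime_factors_multiplicity intro: dvd_power)
      also have "\<dots> = n" using assms by (simp add: prod_prime_factors)
      finally show "\<Prod>A dvd n" .
    qed
    show "finite {d. d dvd n}" using assms by (simp add: finite_divisors_nat)
  qed
  finally show ?thesis by (simp add: tau_def)
qed

text \<open>Summing 1/(ab) over the factorizations n = ab, and relaxing ab \<le> N to a, b \<le>
  N.\<close>

lemma sum_tau_le: "(\<Sum>n=1..N. real (tau n) / real n) \<le> (harm N)\<^sup>2"
proof -
  let ?D = "SIGMA n:{1..N}. {d. d dvd n}"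
  have "(\<Sum>n=1..N. real (tau n) / real n) = (\<Sum>n=1..N. \<Sum>d | d dvd n. 1 / real n)"
    by (simp add: tau_def)
  also have "\<dots> = (\<Sum>(n, d)\<in>?D. 1 / real n)"
    by (subst sum.Sigma) (auto intro: finite_divisors_nat)
  also have "\<dots> = (\<Sum>(a, b)\<in>(\<lambda>(n, d). (d, n div d)) ` ?D. 1 / real a * (1 / real b))"
  proof (subst sum.reindex)
    show "inj_on (\<lambda>(n, d). (d, n div d)) ?D"
      by (auto simp: inj_on_def dvd_def)
  qed (auto intro!: sum.cong elim!: dvdE)
  also have "\<dots> \<le> (\<Sum>(a, b)\<in>{1..N} \<times> {1..N}. 1 / real a * (1 / real b))"
  proof (intro sum_mono2)
    show "(\<lambda>(n, d). (d, n div d)) ` ?D \<subseteq> {1..N} \<times> {1..N}"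
    proof clarify
      fix n d assume nd: "n \<in> {1..N}" "d dvd n"
      then have "d \<le> n" "d > 0" by (auto intro: dvd_imp_le Nat.gr0I)
      moreover have "n div d \<le> N" using nd by (intro order_trans[OF div_le_dividend]) auto
      ultimately show "d \<in> {1..N} \<and> n div d \<in> {1..N}"
        using nd by (auto simp: Suc_le_eq div_greater_zero_iff)
    qed
  qed auto
  also have "\<dots> = (harm N)\<^sup>2"
    by (simp add: sum.cartesian_product[symmetric] sum_product power2_eq_square harm_eq_sum)
  finally show ?thesis .
qed

text \<open>The number of divisors alone cannot control \<open>Omega\<close> well, since 2^k has
  only k + 1 divisors. It bounds the number of distinct primes by log 2 S; the condition on square
  divisors bounds each exponent by 2 log 2 S + 1. The product of the two bounds gives the
  square.\<close>

lemma Omega_le_if_few_divisors: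
  fixes S :: real
  assumes "n > 0" "S \<ge> 2" "real (tau n) \<le> S" "\<And>s. s\<^sup>2 dvd n \<Longrightarrow> real s \<le> S"
  shows "real (Omega n) \<le> 3 * (log 2 S)\<^sup>2"
proof -
  define l where "l = log 2 S"
  have l: "l \<ge> 1" using assms(2) by (simp add: l_def le_log_iff)
  have "real (2 ^ card (prime_factors n)) \<le> S"
    using two_power_card_prime_factors_le[OF assms(1)] assms(3) by (meson of_nat_le_iff order_trans)
  then have card: "real (card (prime_factors n)) \<le> l"
    using assms(2) by (simp add: l_def le_log_iff powr_realpow)
  have mult: "real (multiplicity p n) \<le> 3 * l" if "p \<in> prime_factors n" for p
  proof -
    define a where "a = multiplicity p n div 2"
    have "(p ^ a)\<^sup>2 dvd n"
      unfolding a_def power_mult[symmetric] by (rule multiplicity_dvd') simp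
    then have "real (p ^ a) \<le> S" by (rule assms(4))
    moreover have "2 ^ a \<le> p ^ a" using that by (intro power_mono) (auto intro: prime_ge_2_nat)
    ultimately have "real (2 ^ a) \<le> S" by (meson of_nat_le_iff order_trans)
    then have "real a \<le> l" using assms(2) by (simp add: l_def le_log_iff powr_realpow)
    then have "real (2 * a + 1) \<le> 3 * l" using l by simp
    moreover have "multiplicity p n \<le> 2 * a + 1" by (simp add: a_def)
    ultimately show ?thesis by (meson of_nat_le_iff order_trans)
  qed
  have "real (Omega n) = (\<Sum>p\<in>prime_factors n. real (multiplicity p n))" by (simp add: Omega_eq_sum)
  also have "\<dots> \<le> (\<Sum>p\<in>prime_factors n. 3 * l)" by (intro sum_mono mult)
  also have "\<dots> \<le> 3 * l\<^sup>2" using card l by (simp add: power2_eq_square mult_right_mono)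
  finally show ?thesis by (simp add: l_def)
qed

text \<open>By the preceding bound such an n has more than S divisors or a divisor s^2 with s > S,
  and both events are handled by averaging. With S a power of ln x, \<open>v\<close> only has to be
  of order (ln (ln x))^2 while the reciprocal sum saves that power of ln x, up to the two factors of
  \<open>harm\<close>.\<close>

lemma sum_many_prime_factors_le:
  fixes S :: real
  assumes "S \<ge> 2" "v \<ge> 3 * (log 2 S)\<^sup>2"
  shows "(\<Sum>n | n \<in> {1..N} \<and> v < real (Omega n). 1 / real n) \<le> ((harm N)\<^sup>2 + 2 * harm N) / S"
proof -
  define B where "B = {s. s \<in> {1..N} \<and> S < real s}"
  have "(\<Sum>n | n \<in> {1..N} \<and> v < real (Omega n). 1 / real n)
      \<le> (\<Sum>n=1..N. (real (tau n) / S + (\<Sum>s | s \<in> B \<and> s\<^sup>2 dvd n. 1)) / real n)"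
  proof (intro sum_le_included[where i = id] ballI)
    fix n assume n: "n \<in> {n. n \<in> {1..N} \<and> v < real (Omega n)}"
    then have "\<not> (real (tau n) \<le> S \<and> (\<forall>s. s\<^sup>2 dvd n \<longrightarrow> real s \<le> S))"
      using Omega_le_if_few_divisors[of n S] assms by force
    then consider "real (tau n) > S" | s where "s\<^sup>2 dvd n" "real s > S" by force
    then have "1 \<le> real (tau n) / S + (\<Sum>s | s \<in> B \<and> s\<^sup>2 dvd n. 1)"
    proof cases
      case 1
      then show ?thesis using assms(1) by (intro add_increasing2) (auto simp: field_simps)
    next
      case 2
      have "s \<le> s\<^sup>2" by (simp add: power2_eq_square)
      also have "\<dots> \<le> n" using 2(1) n by (intro dvd_imp_le) auto
      finally have "s \<in> B" using 2 n assms(1) by (auto simp: B_def intro: Nat.gr0I)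
      then have "s \<in> {s. s \<in> B \<and> s\<^sup>2 dvd n}" using 2 by simp
      moreover have "finite {s. s \<in> B \<and> s\<^sup>2 dvd n}" by (simp add: B_def)
      ultimately have "card {s. s \<in> B \<and> s\<^sup>2 dvd n} \<ge> 1"
        by (metis One_nat_def Suc_leI card_gt_0_iff empty_iff)
      then show ?thesis using assms(1) by (intro add_increasing) auto
    qed
    then show "\<exists>y\<in>{1..N}. id y = n \<and>
        1 / real n \<le> (real (tau y) / S + (\<Sum>s | s \<in> B \<and> s\<^sup>2 dvd y. 1)) / real y"
      using n by (intro bexI[of _ n]) (auto simp: divide_right_mono)
  qed (use assms in \<open>auto intro!: divide_nonneg_nonneg add_nonneg_nonneg\<close>)
  also have "\<dots> = (\<Sum>n=1..N. real (tau n) / real n) / S + (\<Sum>n=1..N. \<Sum>s | s \<in> B \<and> s\<^sup>2 dvd n. 1 / real n)"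
    by (simp add: add_divide_distrib sum.distrib sum_divide_distrib mult.commute)
  also have "(\<Sum>n=1..N. \<Sum>s | s \<in> B \<and> s\<^sup>2 dvd n. 1 / real n) = (\<Sum>s\<in>B. \<Sum>n | n \<in> {1..N} \<and> s\<^sup>2 dvd n. 1 / real n)"
    by (rule sum.swap_restrict) (auto simp: B_def)
  also have "\<dots> \<le> (\<Sum>s\<in>B. harm N * (1 / (real s)\<^sup>2))"
  proof (rule sum_mono)
    fix s assume "s \<in> B"
    then show "(\<Sum>n | n \<in> {1..N} \<and> s\<^sup>2 dvd n. 1 / real n) \<le> harm N * (1 / (real s)\<^sup>2)"
      using sum_multiples_le[of "s\<^sup>2" N] by (auto simp: B_def)
  qed
  also have "\<dots> \<le> harm N * (2 / S)"
    unfolding sum_distrib_left[symmetric] B_def using assms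
    by (intro mult_left_mono sum_inverse_squares_le harm_nonneg) auto
  also have "(\<Sum>n=1..N. real (tau n) / real n) / S \<le> (harm N)\<^sup>2 / S"
    using assms by (intro divide_right_mono sum_tau_le) auto
  finally show ?thesis by (simp add: add_divide_distrib mult.commute)
qed

section \<open>Controlling one step of the iteration\<close>

text \<open>The value at a prime r, with \<open>True\<close> for the sum of divisors and
  \<open>False\<close> for the totient and Carmichael's function.\<close>

definition shift :: "bool \<Rightarrow> nat \<Rightarrow> nat" where
  "shift s r = (if s then r + 1 else r - 1)"

text \<open>For r \<ge> 2 both r + 1 and r - 1 are at most 2r, whence the factor 2. The range
  consists of all integers r, since primality will be dropped before this is applied.\<close>

lemma sum_shift_le:
  "(\<Sum>r | r \<in> {2..Y} \<and> P (shift s r). 1 / real r) \<le> 2 * (\<Sum>m | m \<in> {1..Y + 1} \<and> P m. 1 / real m)"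
proof -
  let ?A = "{r. r \<in> {2..Y} \<and> P (shift s r)}"
  have "(\<Sum>r\<in>?A. 1 / real r) \<le> (\<Sum>r\<in>?A. 2 * (1 / real (shift s r)))"
    by (intro sum_mono) (auto simp: shift_def field_simps)
  also have "\<dots> = (\<Sum>m\<in>shift s ` ?A. 2 * (1 / real m))"
    by (subst sum.reindex) (auto simp: inj_on_def shift_def)
  also have "\<dots> \<le> (\<Sum>m | m \<in> {1..Y + 1} \<and> P m. 2 * (1 / real m))"
    by (intro sum_mono2) (auto simp: shift_def)
  finally show ?thesis by (simp add: sum_distrib_left)
qed

text \<open>The case p = q is included and is the important one: it locates the origin of a square
  divisor of the next value.\<close>

lemma prime_mult_dvd_prod:
  fixes h :: "'a \<Rightarrow> nat"
  assumes "finite A" "prime p" "prime q" "p * q dvd prod h A"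
  shows "(\<exists>x\<in>A. p * q dvd h x) \<or> (\<exists>x\<in>A. \<exists>y\<in>A. x \<noteq> y \<and> p dvd h x \<and> q dvd h y)"
proof -
  have "p dvd prod h A" using assms(4) by (rule dvd_mult_left)
  then obtain x where x: "x \<in> A" "p dvd h x" using assms(1,2) by (auto simp: prime_dvd_prod_iff)
  then obtain c where c: "h x = p * c" by (elim dvdE)
  have "prod h A = p * (c * prod h (A - {x}))"
    using x(1) assms(1) by (simp add: prod.remove c)
  then have "q dvd c * prod h (A - {x})"
    using assms(2,4) by (simp add: prime_gt_0_nat)
  then have "q dvd c \<or> q dvd prod h (A - {x})" using assms(3) by (simp add: prime_dvd_mult_iff)
  then show ?thesis
  proof
    assume "q dvd c"
    then have "p * q dvd h x" by (simp add: c)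
    then show ?thesis using x(1) by blast
  next
    assume "q dvd prod h (A - {x})"
    then obtain y where "y \<in> A" "x \<noteq> y" "q dvd h y" using assms(1,3) by (auto simp: prime_dvd_prod_iff)
    then show ?thesis using x by blast
  qed
qed

text \<open>The common features of the three functions. \<open>h p a\<close> is the local factor at
  p^a of a multiple of the value; divisibility suffices, which admits Carmichael's function, an lcm.
  \<open>key p a\<close> is a divisor of the value from which p can be recovered once a is known.
  The bound p^(2a) is crude enough for the sum of divisors as well, as is the factor 1 + ln m in
  \<open>upper\<close>.\<close>

locale step_function =
  fixes \<phi> :: "nat \<Rightarrow> nat" and h key :: "nat \<Rightarrow> nat \<Rightarrow> nat" and s :: bool
  assumes pos: "m > 0 \<Longrightarrow> \<phi> m > 0"
    and dvd_prod: "m > 0 \<Longrightarrow> \<phi> m dvd (\<Prod>p\<in>prime_factors m. h p (multiplicity p m))"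
    and h_pos: "prime p \<Longrightarrow> a > 0 \<Longrightarrow> h p a > 0"
    and h_le: "prime p \<Longrightarrow> a > 0 \<Longrightarrow> h p a \<le> p ^ (2 * a)"
    and h_1: "prime p \<Longrightarrow> h p (Suc 0) = shift s p"
    and key_dvd: "m > 0 \<Longrightarrow> p \<in> prime_factors m \<Longrightarrow> key p (multiplicity p m) dvd \<phi> m"
    and key_inj: "a > 0 \<Longrightarrow> prime p \<Longrightarrow> prime q \<Longrightarrow> key p a = key q a \<Longrightarrow> p = q"
    and upper: "m > 0 \<Longrightarrow> real (\<phi> m) \<le> real m * (1 + ln (real m))"

text \<open>
  Prime factors above the threshold \<open>T\<close> are required to be simple, so that in the next step of the
  iteration each such factor \<open>r\<close> contributes exactly \<open>r \<plusminus> 1\<close>.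
\<close>

definition controlled ::
    "(nat \<Rightarrow> nat) \<Rightarrow> nat set \<Rightarrow> nat \<Rightarrow> nat \<Rightarrow> real \<Rightarrow> real \<Rightarrow> real \<Rightarrow> bool" where
  "controlled f G Y V T K H \<longleftrightarrow> finite G \<and>
     (\<forall>n\<in>G. 0 < f n \<and> f n \<le> Y \<and> Omega (f n) \<le> V \<and> (\<forall>q. prime q \<and> real q > T \<longrightarrow> \<not> q\<^sup>2 dvd f n)) \<and>
     (\<forall>q. prime q \<and> real q > T \<longrightarrow> real (card {n\<in>G. q dvd f n}) \<le> K / real q) \<and>
     (\<forall>q q'. prime q \<and> prime q' \<and> real q > T \<and> real q' > T \<longrightarrow>
        real (card {n\<in>G. q * q' dvd f n}) \<le> K / (real q * real q')) \<and>
     (\<forall>m. real (card {n\<in>G. f n = m}) \<le> H)"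

lemma controlled_mono:
  assumes "controlled f G Y V T K H" "Y \<le> Y'" "V \<le> V'" "T \<le> T'" "K \<le> K'" "H \<le> H'"
  shows "controlled f G Y' V' T' K' H'"
proof -
  have "K / real q \<le> K' / real q" "K / (real q * real q') \<le> K' / (real q * real q')" for q q' :: nat
    using assms by (auto intro!: divide_right_mono)
  then show ?thesis using assms unfolding controlled_def
    by (smt (verit, best) le_trans)
qed

lemma card_Union_le_sum:
  assumes "A \<subseteq> (\<Union>i\<in>I. B i)" "finite I" "\<And>i. i \<in> I \<Longrightarrow> finite (B i)"
    "\<And>i. i \<in> I \<Longrightarrow> real (card (B i)) \<le> c i"
  shows "real (card A) \<le> sum c I"
proof -
  have "card A \<le> card (\<Union>i\<in>I. B i)" using assms by (intro card_mono) auto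
  also have "\<dots> \<le> (\<Sum>i\<in>I. card (B i))" by (rule card_UN_le) fact
  finally have "real (card A) \<le> (\<Sum>i\<in>I. real (card (B i)))" by (simp flip: of_nat_sum)
  also have "\<dots> \<le> sum c I" by (intro sum_mono assms)
  finally show ?thesis .
qed

context step_function
begin

text \<open>The relation between the old threshold \<open>T\<close> and the new one 2^v: a prime r
  \<le> T, with whatever exponent, contributes a factor too small to have more than \<open>v\<close>
  prime factors.\<close>

lemma Omega_h_small:
  assumes "prime r" "real r \<le> T" "0 < a" "a \<le> V" "T ^ (2 * V) \<le> 2 ^ v"
  shows "h r a \<le> 2 ^ v" "Omega (h r a) \<le> v"
proof -
  have r: "real r \<ge> 1" using prime_gt_0_nat[OF assms(1)] by simp
  have "real (h r a) \<le> real r ^ (2 * a)" using h_le[OF assms(1,3)] by (metis of_nat_le_iff of_nat_power)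
  also have "\<dots> \<le> real r ^ (2 * V)" using assms r by (intro power_increasing) auto
  also have "\<dots> \<le> T ^ (2 * V)" using assms by (intro power_mono) auto
  also have "\<dots> \<le> 2 ^ v" by fact
  finally have "real (h r a) \<le> real (2 ^ v)" by simp
  then show *: "h r a \<le> 2 ^ v" by (simp only: of_nat_le_iff)
  have "2 ^ Omega (h r a) \<le> h r a" using h_pos assms by (intro two_power_Omega_le) auto
  then have "(2::nat) ^ Omega (h r a) \<le> 2 ^ v" using * by (rule order_trans)
  then show "Omega (h r a) \<le> v" by simp
qed

text \<open>A prime above the new threshold 2^v exceeds the local factors of all r \<le> T, so it
  can only arise from some r > T, and such r are simple.\<close>

lemma large_prime_dvd_h:
  assumes "m > 0" "Omega m \<le> V" "\<And>q. prime q \<Longrightarrow> real q > T \<Longrightarrow> \<not> q\<^sup>2 dvd m"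
    and "T ^ (2 * V) \<le> 2 ^ v" "q > 2 ^ v" "r \<in> prime_factors m" "q dvd h r (multiplicity r m)"
  shows "real r > T" "h r (multiplicity r m) = shift s r"
proof -
  have r: "prime r" and a: "multiplicity r m > 0" using assms(6) by (auto simp: prime_factors_multiplicity)
  show T: "real r > T"
  proof (rule ccontr)
    assume "\<not> real r > T"
    then have "h r (multiplicity r m) \<le> 2 ^ v"
      using r a assms(2,4,6) multiplicity_le_Omega[OF assms(6)] by (intro Omega_h_small(1)) auto
    moreover have "q \<le> h r (multiplicity r m)" using assms(7) h_pos[OF r a] by (rule dvd_imp_le)
    ultimately show False using assms(5) by simp
  qed
  have "multiplicity r m < 2"
  proof (rule ccontr)
    assume "\<not> multiplicity r m < 2"
    then have "r\<^sup>2 dvd m" by (intro multiplicity_dvd') simp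
    then show False using assms(3) r T by blast
  qed
  then have "multiplicity r m = Suc 0" using a by simp
  then show "h r (multiplicity r m) = shift s r" by (simp add: h_1 r)
qed

lemma card_same_image_le:
  assumes "m' > 0" "Omega m' \<le> V'"
  shows "finite {m. m > 0 \<and> Omega m \<le> V \<and> \<phi> m = m'}"
    and "card {m. m > 0 \<and> Omega m \<le> V \<and> \<phi> m = m'} \<le> (V * 2 ^ V' + 1) ^ V"
proof -
  define M where "M = {m. m > 0 \<and> Omega m \<le> V \<and> \<phi> m = m'}"
  \<comment> \<open>All prime powers that can occur in a preimage. The pair of
    \<open>key p a\<close> and a determines p, so the pool is no larger than the number of divisors
    of m' times \<open>V\<close>.\<close>
  define Pool where "Pool = {(p, a). prime p \<and> 0 < a \<and> a \<le> V \<and> key p a dvd m'}"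
  define D where "D = {d. d dvd m'}"
  have finD: "finite D" using assms(1) by (simp add: D_def finite_divisors_nat)
  have inj: "inj_on (\<lambda>(p, a). (key p a, a)) Pool"
    by (auto simp: inj_on_def Pool_def dest: key_inj)
  have sub: "(\<lambda>(p, a). (key p a, a)) ` Pool \<subseteq> D \<times> {1..V}"
    by (auto simp: Pool_def D_def)
  have finPool: "finite Pool" using inj_on_finite[OF inj sub] finD by simp
  have "card Pool \<le> card (D \<times> {1..V})" using inj sub finD by (intro card_inj_on_le) auto
  also have "\<dots> = tau m' * V" by (simp add: card_cartesian_product D_def tau_def)
  also have "\<dots> \<le> 2 ^ V' * V"
    using tau_le_two_power_Omega[OF assms(1)] assms(2)
    by (intro mult_right_mono) (auto intro: order_trans power_increasing)
  finally have cardPool: "card Pool \<le> V * 2 ^ V'" by (simp add: mult.commute)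
  define pairs where "pairs = (\<lambda>m::nat. (\<lambda>p. (p, multiplicity p m)) ` prime_factors m)"
  \<comment> \<open>A preimage has at most \<open>V\<close> distinct primes, so it is coded by a
    list of length \<open>V\<close> over the pool. The pair (0, 0) serves as padding, since 0 is not
    prime.\<close>
  define L where "L = {xs. set xs \<subseteq> insert (0, 0) Pool \<and> length xs = V}"
  have finL: "finite L" unfolding L_def using finPool by (intro finite_lists_length_eq) simp
  have inj2: "inj_on pairs M"
  proof (rule inj_onI)
    fix m n assume mn: "m \<in> M" "n \<in> M" "pairs m = pairs n"
    have pf: "prime_factors x = fst ` pairs x" for x
      by (simp add: pairs_def image_image)
    have "multiplicity p m = multiplicity p n" if "p \<in> prime_factors m" for p
    proof -
      have "(p, multiplicity p m) \<in> pairs n" using that mn(3) by (auto simp: pairs_def)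
      then show ?thesis by (auto simp: pairs_def)
    qed
    moreover have eq: "prime_factors m = prime_factors n" using mn(3) by (simp add: pf)
    ultimately have "(\<Prod>p\<in>prime_factors m. p ^ multiplicity p m) = (\<Prod>p\<in>prime_factors n. p ^ multiplicity p n)"
      by (intro prod.cong) auto
    then show "m = n" using mn(1,2) by (simp add: M_def prod_prime_factors)
  qed
  have sub2: "pairs ` M \<subseteq> (\<lambda>xs. set xs - {(0, 0)}) ` L"
  proof (rule image_subsetI)
    fix m assume m: "m \<in> M"
    have fin: "finite (pairs m)" by (simp add: pairs_def)
    have "pairs m \<subseteq> Pool"
    proof
      fix x assume "x \<in> pairs m"
      then obtain p where p: "p \<in> prime_factors m" "x = (p, multiplicity p m)" by (auto simp: pairs_def)
      then show "x \<in> Pool"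
        using m multiplicity_le_Omega[OF p(1)] key_dvd[of m p]
        by (auto simp: Pool_def M_def prime_factors_multiplicity)
    qed
    moreover have "card (pairs m) \<le> V"
      using m card_prime_factors_le_Omega[of m] card_image_le[of "prime_factors m" "\<lambda>p. (p, multiplicity p m)"]
      by (simp add: M_def pairs_def)
    moreover obtain xs where xs: "set xs = pairs m" "distinct xs"
      using finite_distinct_list[OF fin] by blast
    ultimately have inL: "xs @ replicate (V - length xs) (0, 0) \<in> L"
      by (auto simp: L_def distinct_card[symmetric])
    have "(0, 0) \<notin> pairs m" by (auto simp: pairs_def)
    then have "set xs - {(0, 0)} = pairs m" unfolding xs(1) by blast
    moreover have "set (xs @ replicate k z) - {z} = set xs - {z}" for k and z :: "nat \<times> nat" by auto
    ultimately have "pairs m = set (xs @ replicate (V - length xs) (0, 0)) - {(0, 0)}"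
      by simp
    with inL show "pairs m \<in> (\<lambda>xs. set xs - {(0, 0)}) ` L" by (rule rev_image_eqI)
  qed
  have fin2: "finite ((\<lambda>xs. set xs - {(0, 0)}) ` L)" using finL by simp
  show "finite {m. m > 0 \<and> Omega m \<le> V \<and> \<phi> m = m'}"
    using inj_on_finite[OF inj2 sub2 fin2] by (simp add: M_def)
  have "card M \<le> card ((\<lambda>xs. set xs - {(0, 0)}) ` L)" using inj2 sub2 fin2 by (rule card_inj_on_le)
  also have "\<dots> \<le> card L" by (rule card_image_le[OF finL])
  also have "\<dots> = card (insert (0, 0) Pool) ^ V"
    unfolding L_def using finPool by (intro card_lists_length_eq) simp
  also have "\<dots> \<le> (V * 2 ^ V' + 1) ^ V"
    using cardPool card_insert_le_m1[of "V * 2 ^ V' + 1" Pool "(0,0)"] by (intro power_mono) auto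
  finally show "card {m. m > 0 \<and> Omega m \<le> V \<and> \<phi> m = m'} \<le> (V * 2 ^ V' + 1) ^ V" by (simp add: M_def)
qed

text \<open>\<open>A\<close> is the price of one sum of 1/r over r in a residue class. A square
  divisor or a product q q' costs at most A from one prime r and A^2 from two, hence the factor 2
  A^2 in the new \<open>K\<close>. The parameter \<open>S\<close> measures how rare it is that r
  \<plusminus> 1 has more than \<open>v\<close> prime factors and can be chosen freely against the
  loss in \<open>K\<close> and \<open>A\<close>.\<close>

theorem controlled_step:
  fixes T K H S :: real
  assumes ctrl: "controlled f G Y V T K H"
    and Tv: "T ^ (2 * V) \<le> 2 ^ v" and K: "K \<ge> 0"
    and Y': "\<And>m. 0 < m \<Longrightarrow> m \<le> Y \<Longrightarrow> \<phi> m \<le> Y'"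
    and S: "S \<ge> 2" "real v \<ge> 3 * (log 2 S)\<^sup>2"
    and A: "2 * harm (Y + 1) \<le> A" "A \<ge> 1"
  shows "\<exists>G' \<subseteq> G. controlled (\<phi> \<circ> f) G' Y' (V * v) (2 ^ v) (2 * A\<^sup>2 * K) (H * (real V * 2 ^ (V * v) + 1) ^ V)
    \<and> real (card (G - G')) \<le> 2 * K * A\<^sup>2 / S + 4 * A\<^sup>2 * K / 2 ^ v"
proof -
  let ?T' = "2 ^ v :: real"
  have finG: "finite G" using ctrl by (simp add: controlled_def)
  have f: "0 < f n" "f n \<le> Y" "Omega (f n) \<le> V" "\<And>q. prime q \<Longrightarrow> real q > T \<Longrightarrow> \<not> q\<^sup>2 dvd f n"
    if "n \<in> G" for n using that ctrl by (auto simp: controlled_def)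
  have count1: "real (card {n\<in>G. q dvd f n}) \<le> K / real q" if "prime q" "real q > T" for q
    using ctrl that by (simp add: controlled_def)
  have count2: "real (card {n\<in>G. q * q' dvd f n}) \<le> K / (real q * real q')"
    if "prime q" "prime q'" "real q > T" "real q' > T" for q q'
    using ctrl that by (simp add: controlled_def)
  have A0: "A \<ge> 0" "A \<le> A\<^sup>2" using A(2) by (auto simp: power2_eq_square)
  define R where "R = (\<lambda>q. {r. r \<in> {2..Y} \<and> q dvd shift s r})"
  have finR: "finite (R q)" for q by (simp add: R_def)
  have sumR: "(\<Sum>r\<in>R q. 1 / real r) \<le> A / real q" if "q > 0" for q
  proof -
    have "(\<Sum>r\<in>R q. 1 / real r) \<le> 2 * (harm (Y + 1) / real q)"
      unfolding R_def using sum_shift_le[where P = "\<lambda>m. q dvd m"] sum_multiples_le[OF that, of "Y + 1"]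
      by (meson mult_left_mono order_trans zero_le_numeral)
    also have "\<dots> \<le> A / real q" using A(1) by (simp add: divide_right_mono)
    finally show ?thesis .
  qed
  have inR: "r \<in> R q" "prime r" "r dvd f n" if "n \<in> G" "r \<in> prime_factors (f n)" "q dvd shift s r" for n r q
  proof -
    have "r \<le> f n" "prime r" "r dvd f n" using f(1)[OF that(1)] that(2) by (auto intro: dvd_imp_le)
    then show "r \<in> R q" "prime r" "r dvd f n" using f(2)[OF that(1)] that(3) prime_ge_2_nat
      by (auto simp: R_def)
  qed
  have large: "q > 2 ^ v" if "real q > ?T'" for q
  proof -
    have "real (2 ^ v) < real q" using that by simp
    then show ?thesis by (simp only: of_nat_less_iff)
  qed
  have lp: "r \<in> R d \<and> prime r \<and> r dvd f n \<and> real r > T"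
    if nr: "n \<in> G" "r \<in> prime_factors (f n)" and q: "real q > ?T'" "q dvd d"
      and d: "d dvd h r (multiplicity r (f n))" for n r q d
  proof -
    note L = large_prime_dvd_h[OF f(1)[OF nr(1)] f(3)[OF nr(1)] f(4)[OF nr(1)] Tv large[OF q(1)] nr(2) dvd_trans[OF q(2) d]]
    have "d dvd shift s r" using d by (simp only: L(2))
    from inR[OF nr this] L(1) show ?thesis by simp
  qed
  have c1: "real (card {n\<in>G. q dvd \<phi> (f n)}) \<le> 2 * A\<^sup>2 * K / real q"
    if q: "prime q" "real q > ?T'" for q
  proof -
    have "real (card {n\<in>G. q dvd \<phi> (f n)}) \<le> (\<Sum>r | r \<in> R q \<and> prime r \<and> real r > T. K / real r)"
    proof (rule card_Union_le_sum[where B = "\<lambda>r. {n\<in>G. r dvd f n}"])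
      show "{n\<in>G. q dvd \<phi> (f n)} \<subseteq> (\<Union>r\<in>{r. r \<in> R q \<and> prime r \<and> real r > T}. {n\<in>G. r dvd f n})"
      proof clarify
        fix n assume n: "n \<in> G" "q dvd \<phi> (f n)"
        have "q dvd (\<Prod>p\<in>prime_factors (f n). h p (multiplicity p (f n)))"
          using n(2) dvd_prod[OF f(1)[OF n(1)]] by (rule dvd_trans)
        then have "\<exists>r\<in>prime_factors (f n). q dvd h r (multiplicity r (f n))"
          by (rule prime_dvd_prod_iff[THEN iffD1, OF finite_set_mset q(1)])
        then obtain r where r: "r \<in> prime_factors (f n)" "q dvd h r (multiplicity r (f n))" ..
        note L = lp[OF n(1) r(1) q(2) dvd_refl r(2)]
        show "n \<in> (\<Union>r\<in>{r. r \<in> R q \<and> prime r \<and> real r > T}. {n\<in>G. r dvd f n})"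
          by (rule UN_I[of r]) (use L n(1) in simp_all)
      qed
    qed (use finR finG count1 in auto)
    \<comment> \<open>Primality of r is given up here, in place of a sieve; the cost is the
      logarithmic factor in \<open>A\<close>.\<close>
    also have "\<dots> \<le> (\<Sum>r\<in>R q. K / real r)" using K by (intro sum_mono2 finR) auto
    also have "\<dots> = K * (\<Sum>r\<in>R q. 1 / real r)" by (simp add: sum_distrib_left)
    also have "\<dots> \<le> K * (A / real q)" using q K by (intro mult_left_mono sumR) (auto simp: prime_gt_0_nat)
    also have "\<dots> \<le> K * (2 * A\<^sup>2 / real q)" using A0 K by (intro mult_left_mono divide_right_mono) auto
    finally show ?thesis by (simp add: mult.commute)
  qed
  have c2: "real (card {n\<in>G. q * q' dvd \<phi> (f n)}) \<le> 2 * A\<^sup>2 * K / (real q * real q')"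
    if q: "prime q" "prime q'" "real q > ?T'" "real q' > ?T'" for q q'
  proof -
    have q0: "q > 0" "q' > 0" using q by (auto simp: prime_gt_0_nat)
    \<comment> \<open>\<open>I1\<close> lists the single primes r with q q' dividing r \<plusminus>
      1, \<open>I2\<close> the pairs of primes receiving q and q' separately.\<close>
    define I1 where "I1 = {r. r \<in> R (q * q') \<and> prime r \<and> real r > T}"
    define I2 where "I2 = {r. r \<in> R q \<and> prime r \<and> real r > T} \<times> {r. r \<in> R q' \<and> prime r \<and> real r > T}"
    define C1 where "C1 = {n\<in>G. \<exists>r\<in>I1. r dvd f n}"
    define C2 where "C2 = {n\<in>G. \<exists>(r, r')\<in>I2. r * r' dvd f n}"
    have "{n\<in>G. q * q' dvd \<phi> (f n)} \<subseteq> C1 \<union> C2"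
    proof clarify
      fix n assume n: "n \<in> G" "q * q' dvd \<phi> (f n)" "n \<notin> C2"
      have "q * q' dvd (\<Prod>p\<in>prime_factors (f n). h p (multiplicity p (f n)))"
        using n(2) dvd_prod[OF f(1)[OF n(1)]] by (rule dvd_trans)
      then consider (one) r where "r \<in> prime_factors (f n)" "q * q' dvd h r (multiplicity r (f n))"
        | (two) r r' where "r \<in> prime_factors (f n)" "r' \<in> prime_factors (f n)" "r \<noteq> r'"
            "q dvd h r (multiplicity r (f n))" "q' dvd h r' (multiplicity r' (f n))"
        using prime_mult_dvd_prod[OF finite_set_mset q(1,2)] by blast
      then show "n \<in> C1"
      proof cases
        case one
        note L = lp[OF n(1) one(1) q(3) dvd_triv_left one(2)]
        show ?thesis unfolding C1_def I1_def by (rule CollectI, intro conjI bexI[of _ r]) (use L n(1) in simp_all)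
      next
        case two
        note r = lp[OF n(1) two(1) q(3) dvd_refl two(4)]
        note r' = lp[OF n(1) two(2) q(4) dvd_refl two(5)]
        have "coprime r r'" using r r' two(3) by (intro primes_coprime) auto
        then have "r * r' dvd f n" using r r' by (intro divides_mult) auto
        then have "n \<in> C2" unfolding C2_def I2_def
          by (intro CollectI conjI bexI[of _ "(r, r')"]) (use r r' n(1) in simp_all)
        then show ?thesis using n(3) by blast
      qed
    qed
    then have "card {n\<in>G. q * q' dvd \<phi> (f n)} \<le> card C1 + card C2"
      using finG by (intro order_trans[OF card_mono card_Un_le]) (auto simp: C1_def C2_def)
    then have "real (card {n\<in>G. q * q' dvd \<phi> (f n)}) \<le> real (card C1) + real (card C2)" by linarith
    also have "real (card C1) \<le> (\<Sum>r\<in>I1. K / real r)"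
      by (rule card_Union_le_sum[where B = "\<lambda>r. {n\<in>G. r dvd f n}"])
         (use finR finG count1 in \<open>auto simp: C1_def I1_def\<close>)
    also have "\<dots> \<le> (\<Sum>r\<in>R (q * q'). K / real r)" using K by (intro sum_mono2 finR) (auto simp: I1_def)
    also have "\<dots> = K * (\<Sum>r\<in>R (q * q'). 1 / real r)" by (simp add: sum_distrib_left)
    also have "\<dots> \<le> K * (A / real (q * q'))" using q0 K by (intro mult_left_mono sumR) auto
    also have "\<dots> \<le> K * (A\<^sup>2 / real (q * q'))" using A0 K by (intro mult_left_mono divide_right_mono) auto
    also have "real (card C2) \<le> (\<Sum>(r, r')\<in>I2. K / (real r * real r'))"
    proof (rule card_Union_le_sum[where B = "\<lambda>(r, r'). {n\<in>G. r * r' dvd f n}"])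
      show "real (card (case i of (r, r') \<Rightarrow> {n \<in> G. r * r' dvd f n})) \<le> (case i of (r, r') \<Rightarrow> K / (real r * real r'))"
        if "i \<in> I2" for i using that by (auto simp: I2_def intro!: count2)
    qed (use finR finG in \<open>auto simp: C2_def I2_def\<close>)
    also have "\<dots> \<le> (\<Sum>(r, r')\<in>R q \<times> R q'. K / (real r * real r'))"
      using K finR by (intro sum_mono2) (auto simp: I2_def)
    also have "\<dots> = K * ((\<Sum>r\<in>R q. 1 / real r) * (\<Sum>r\<in>R q'. 1 / real r))"
      by (subst sum_product, unfold sum.cartesian_product, subst sum_distrib_left) (simp add: case_prod_unfold)
    also have "\<dots> \<le> K * ((A / real q) * (A / real q'))"
      using q0 K A0 by (intro mult_left_mono mult_mono sumR) (auto intro!: sum_nonneg divide_nonneg_nonneg)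
    finally show ?thesis by (simp add: power2_eq_square algebra_simps add_divide_distrib[symmetric])
  qed
  \<comment> \<open>Only these two sets are removed: \<open>bad1\<close> would destroy the bound for
    the number of prime factors, \<open>bad2\<close> the simplicity of the prime factors above the
    new threshold. The divisibility counts and fibre bounds pass to subsets.\<close>
  define bad1 where "bad1 = {n\<in>G. \<exists>r. prime r \<and> real r > T \<and> r dvd f n \<and> v < Omega (shift s r)}"
  define bad2 where "bad2 = {n\<in>G. \<exists>q. prime q \<and> real q > ?T' \<and> q\<^sup>2 dvd \<phi> (f n)}"
  define G' where "G' = G - (bad1 \<union> bad2)"
  have fG': "Omega (\<phi> (f n)) \<le> V * v" if n: "n \<in> G'" for n
  proof -
    let ?P = "prime_factors (f n)"
    have nG: "n \<in> G" using n by (simp add: G'_def)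
    have ppos: "h r (multiplicity r (f n)) > 0" if "r \<in> ?P" for r
      using that by (intro h_pos) (auto simp: prime_factors_multiplicity)
    have "Omega (\<phi> (f n)) \<le> Omega (\<Prod>r\<in>?P. h r (multiplicity r (f n)))"
      using dvd_prod[OF f(1)[OF nG]] ppos by (intro Omega_dvd_mono) (auto intro!: prod_pos)
    also have "\<dots> = (\<Sum>r\<in>?P. Omega (h r (multiplicity r (f n))))"
      using ppos by (rule Omega_prod)
    also have "\<dots> \<le> (\<Sum>r\<in>?P. v)"
    proof (rule sum_mono)
      fix r assume r: "r \<in> ?P"
      then have pr: "prime r" and a: "multiplicity r (f n) > 0" by (auto simp: prime_factors_multiplicity)
      show "Omega (h r (multiplicity r (f n))) \<le> v"
      proof (cases "real r \<le> T")
        case True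
        then show ?thesis using pr a f(3)[OF nG] multiplicity_le_Omega[OF r] Tv
          by (intro Omega_h_small(2)) auto
      next
        case False
        have "multiplicity r (f n) < 2"
        proof (rule ccontr)
          assume "\<not> multiplicity r (f n) < 2"
          then have "r\<^sup>2 dvd f n" by (intro multiplicity_dvd') simp
          then show False using f(4)[OF nG pr] False by simp
        qed
        then have "h r (multiplicity r (f n)) = shift s r" using a h_1[OF pr] by (simp add: less_Suc_eq numeral_2_eq_2)
        moreover have "Omega (shift s r) \<le> v"
        proof (rule ccontr)
          assume "\<not> Omega (shift s r) \<le> v"
          then have "n \<in> bad1" unfolding bad1_def using nG False pr r
            by (intro CollectI conjI exI[of _ r]) auto
          then show False using n by (simp add: G'_def)
        qed
        ultimately show ?thesis by simp
      qed
    qed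
    also have "\<dots> = card ?P * v" by simp
    also have "\<dots> \<le> V * v" using card_prime_factors_le_Omega[of "f n"] f(3)[OF nG] by (intro mult_right_mono) auto
    finally show ?thesis .
  qed
  \<comment> \<open>A fibre of the composition is a union of old fibres over the preimages m of m'.
    Both m and m' have few prime factors, so these preimages can be counted.\<close>
  have mult: "real (card {n\<in>G'. \<phi> (f n) = m'}) \<le> H * (real V * 2 ^ (V * v) + 1) ^ V" for m'
  proof (cases "{n\<in>G'. \<phi> (f n) = m'} = {}")
    case True
    have "H \<ge> 0" using ctrl unfolding controlled_def by (meson of_nat_0_le_iff order_trans)
    then show ?thesis unfolding True by simp
  next
    case False
    then obtain n0 where n0: "n0 \<in> G'" "\<phi> (f n0) = m'" by auto
    have m': "m' > 0" "Omega m' \<le> V * v" using n0 fG'[OF n0(1)] pos f(1) by (auto simp: G'_def)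
    define M where "M = {m. m > 0 \<and> Omega m \<le> V \<and> \<phi> m = m'}"
    have H0: "H \<ge> 0" using ctrl unfolding controlled_def by (meson of_nat_0_le_iff order_trans)
    have "real (card {n\<in>G'. \<phi> (f n) = m'}) \<le> (\<Sum>m\<in>M. H)"
      using card_same_image_le(1)[OF m', of V] f finG ctrl
      by (intro card_Union_le_sum[where B = "\<lambda>m. {n\<in>G. f n = m}"]) (auto simp: M_def G'_def controlled_def)
    also have "\<dots> = real (card M) * H" by simp
    also have "\<dots> \<le> real ((V * 2 ^ (V * v) + 1) ^ V) * H"
      unfolding M_def using H0 by (intro mult_right_mono of_nat_mono card_same_image_le(2) m')
    finally show ?thesis by (simp add: mult.commute add.commute)
  qed
  have "controlled (\<phi> \<circ> f) G' Y' (V * v) ?T' (2 * A\<^sup>2 * K) (H * (real V * 2 ^ (V * v) + 1) ^ V)"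
    unfolding controlled_def o_def
  proof (intro conjI ballI allI impI)
    show "finite G'" using finG by (simp add: G'_def)
    fix n assume n: "n \<in> G'"
    then have nG: "n \<in> G" by (simp add: G'_def)
    show "0 < \<phi> (f n)" using f(1)[OF nG] by (rule pos)
    show "\<phi> (f n) \<le> Y'" using f[OF nG] by (intro Y')
    show "Omega (\<phi> (f n)) \<le> V * v" using n by (rule fG')
    fix q assume "prime q \<and> ?T' < real q"
    then show "\<not> q\<^sup>2 dvd \<phi> (f n)" using n nG by (auto simp: G'_def bad2_def)
  next
    fix q assume q: "prime q \<and> ?T' < real q"
    have "card {n \<in> G'. q dvd \<phi> (f n)} \<le> card {n \<in> G. q dvd \<phi> (f n)}"
      using finG by (intro card_mono) (auto simp: G'_def)
    then show "real (card {n \<in> G'. q dvd \<phi> (f n)}) \<le> 2 * A\<^sup>2 * K / real q"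
      using c1 q by (meson of_nat_le_iff order_trans)
  next
    fix q q' assume q: "prime q \<and> prime q' \<and> ?T' < real q \<and> ?T' < real q'"
    have "card {n \<in> G'. q * q' dvd \<phi> (f n)} \<le> card {n \<in> G. q * q' dvd \<phi> (f n)}"
      using finG by (intro card_mono) (auto simp: G'_def)
    then show "real (card {n \<in> G'. q * q' dvd \<phi> (f n)}) \<le> 2 * A\<^sup>2 * K / (real q * real q')"
      using c2 q by (meson of_nat_le_iff order_trans)
  qed (rule mult)
  moreover have "real (card (G - G')) \<le> 2 * K * A\<^sup>2 / S + 4 * A\<^sup>2 * K / 2 ^ v"
  proof -
    have fin: "finite bad1" "finite bad2" using finG by (auto simp: bad1_def bad2_def)
    have "real (card bad1) \<le> (\<Sum>r | r \<in> {2..Y} \<and> prime r \<and> real r > T \<and> real v < real (Omega (shift s r)). K / real r)"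
    proof (rule card_Union_le_sum[where B = "\<lambda>r. {n\<in>G. r dvd f n}"])
      show "bad1 \<subseteq> (\<Union>r\<in>{r. r \<in> {2..Y} \<and> prime r \<and> real r > T \<and> real v < real (Omega (shift s r))}. {n\<in>G. r dvd f n})"
      proof
        fix n assume "n \<in> bad1"
        then obtain r where r: "n \<in> G" "prime r" "real r > T" "r dvd f n" "v < Omega (shift s r)"
          by (auto simp: bad1_def)
        have "r \<le> Y" using dvd_imp_le[OF r(4) f(1)[OF r(1)]] f(2)[OF r(1)] by simp
        then show "n \<in> (\<Union>r\<in>{r. r \<in> {2..Y} \<and> prime r \<and> real r > T \<and> real v < real (Omega (shift s r))}. {n\<in>G. r dvd f n})"
          using r prime_ge_2_nat[OF r(2)] by auto
      qed
    qed (use finG count1 in auto)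
    also have "\<dots> \<le> (\<Sum>r | r \<in> {2..Y} \<and> real v < real (Omega (shift s r)). K / real r)"
      using K by (intro sum_mono2) auto
    also have "\<dots> = K * (\<Sum>r | r \<in> {2..Y} \<and> real v < real (Omega (shift s r)). 1 / real r)"
      by (simp add: sum_distrib_left)
    also have "\<dots> \<le> K * (2 * (\<Sum>m | m \<in> {1..Y + 1} \<and> real v < real (Omega m). 1 / real m))"
      using K by (intro mult_left_mono sum_shift_le)
    also have "\<dots> \<le> K * (2 * (((harm (Y + 1))\<^sup>2 + 2 * harm (Y + 1)) / S))"
      using K by (intro mult_left_mono sum_many_prime_factors_le S) auto
    \<comment> \<open>With h = \<open>harm (Y + 1)\<close> \<ge> 1 and 2h \<le> A one has h^2 + 2h
      \<le> 3 h^2 \<le> A^2.\<close>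
    also have "\<dots> \<le> K * (2 * (A\<^sup>2 / S))"
    proof -
      have h: "harm (Y + 1) \<le> A / 2" "(harm (Y + 1) :: real) \<ge> 1"
        using A(1) harm_mono[of 1 "Y + 1"] by (auto simp: harm_expand)
      then have "(harm (Y + 1) :: real)\<^sup>2 \<le> (A / 2)\<^sup>2" by (intro power_mono) auto
      moreover have "2 * harm (Y + 1) \<le> 2 * (harm (Y + 1) :: real)\<^sup>2"
        using h(2) by (simp add: power2_eq_square)
      moreover have "(A / 2)\<^sup>2 = A\<^sup>2 / 4" "A\<^sup>2 \<ge> 0" by (simp_all add: power_divide)
      ultimately have "(harm (Y + 1))\<^sup>2 + 2 * harm (Y + 1) \<le> A\<^sup>2" by linarith
      then show ?thesis using K S by (intro mult_left_mono divide_right_mono) auto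
    qed
    finally have b1: "real (card bad1) \<le> 2 * K * A\<^sup>2 / S" by (simp add: mult_ac)
    \<comment> \<open>The count for products of two primes, applied with q = q'.\<close>
    have "real (card bad2) \<le> (\<Sum>q | q \<in> {1..Y'} \<and> prime q \<and> ?T' < real q. 2 * A\<^sup>2 * K / (real q * real q))"
    proof (rule card_Union_le_sum[where B = "\<lambda>q. {n\<in>G. q * q dvd \<phi> (f n)}"])
      show "bad2 \<subseteq> (\<Union>q\<in>{q. q \<in> {1..Y'} \<and> prime q \<and> ?T' < real q}. {n\<in>G. q * q dvd \<phi> (f n)})"
      proof
        fix n assume "n \<in> bad2"
        then obtain q where q: "n \<in> G" "prime q" "real q > ?T'" "q\<^sup>2 dvd \<phi> (f n)" by (auto simp: bad2_def)
        have "q dvd \<phi> (f n)" using q(4) by (simp add: power2_eq_square dvd_mult_left)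
        then have "q \<le> \<phi> (f n)" using pos f(1)[OF q(1)] by (intro dvd_imp_le) auto
        also have "\<dots> \<le> Y'" using f[OF q(1)] by (intro Y')
        finally show "n \<in> (\<Union>q\<in>{q. q \<in> {1..Y'} \<and> prime q \<and> ?T' < real q}. {n\<in>G. q * q dvd \<phi> (f n)})"
          using q prime_gt_0_nat[OF q(2)] by (intro UN_I[of q]) (auto simp: power2_eq_square Suc_le_eq)
      qed
    qed (use finG in \<open>auto intro!: c2\<close>)
    also have "\<dots> \<le> (\<Sum>q | q \<in> {1..Y'} \<and> ?T' < real q. 2 * A\<^sup>2 * K / (real q * real q))"
      using K by (intro sum_mono2) auto
    also have "\<dots> = 2 * A\<^sup>2 * K * (\<Sum>q | q \<in> {1..Y'} \<and> ?T' < real q. 1 / (real q)\<^sup>2)"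
      by (simp add: sum_distrib_left power2_eq_square)
    also have "\<dots> \<le> 2 * A\<^sup>2 * K * (2 / ?T')"
      using K by (intro mult_left_mono sum_inverse_squares_le) auto
    finally have b2: "real (card bad2) \<le> 4 * A\<^sup>2 * K / 2 ^ v" by simp
    have "card (G - G') \<le> card (bad1 \<union> bad2)" using fin by (intro card_mono) (auto simp: G'_def)
    also have "\<dots> \<le> card bad1 + card bad2" by (rule card_Un_le)
    finally show ?thesis using b1 b2 by linarith
  qed
  ultimately show ?thesis by (intro exI[of _ G']) (auto simp: G'_def)
qed

end

section \<open>Totient, Carmichael function and sum of divisors\<close>

lemma le_times_one_plus_ln:
  assumes "n > 0" "m \<le> n"
  shows "real m \<le> real n * (1 + ln (real n))"
proof -
  have "real m \<le> real n" using assms by simp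
  also have "\<dots> \<le> real n * (1 + ln (real n))" using assms by (simp add: mult_le_cancel_left1)
  finally show ?thesis .
qed

lemma minus_one_dvd_totient: "m > 0 \<Longrightarrow> p \<in> prime_factors m \<Longrightarrow> p - 1 dvd totient m"
  by (subst totient_formula1) (auto intro!: dvd_trans[OF _ dvd_prodI[of _ p]])

lemma minus_one_dvd_Carmichael: "p \<in> prime_factors m \<Longrightarrow> p - 1 dvd Carmichael m"
  unfolding Carmichael_closed_formula
  by (rule dvd_trans[OF _ dvd_Lcm[OF imageI[of p]]]) (auto simp: Let_def)

lemma totient_prime_power_le: "prime p \<Longrightarrow> a > 0 \<Longrightarrow> p ^ (a - 1) * (p - 1) \<le> p ^ (2 * a)" for p :: nat
proof -
  assume p: "prime p" "a > 0"
  have "p ^ (a - 1) * (p - 1) \<le> p ^ (a - 1) * p" by simp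
  also have "\<dots> = p ^ a" using p by (simp flip: power_Suc2)
  also have "\<dots> \<le> p ^ (2 * a)" using p by (intro power_increasing) (auto simp: Suc_le_eq prime_gt_0_nat)
  finally show ?thesis .
qed

interpretation totient: step_function totient "\<lambda>p a. p ^ (a - 1) * (p - 1)" "\<lambda>p a. p - 1" False
proof
  fix m :: nat assume m: "m > 0"
  show "totient m > 0" using m by simp
  show "totient m dvd (\<Prod>p\<in>prime_factors m. p ^ (multiplicity p m - 1) * (p - 1))"
    using totient_formula1[OF m] by (simp only: dvd_refl)
  show "real (totient m) \<le> real m * (1 + ln (real m))"
    using m totient_le by (rule le_times_one_plus_ln)
  show "p - 1 dvd totient m" if "p \<in> prime_factors m" for p
    using m that by (rule minus_one_dvd_totient)
next
  fix p a :: nat assume p: "prime p" "a > 0"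
  show "p ^ (a - 1) * (p - 1) > 0" using prime_gt_1_nat[OF p(1)] by simp
  show "p ^ (a - 1) * (p - 1) \<le> p ^ (2 * a)" using p by (rule totient_prime_power_le)
next
  fix p :: nat
  show "p ^ (Suc 0 - 1) * (p - 1) = shift False p" by (simp add: shift_def)
next
  fix p q :: nat assume "prime p" "prime q" "p - 1 = q - 1"
  then show "p = q" using prime_gt_0_nat[of p] prime_gt_0_nat[of q] by linarith
qed

text \<open>The local factors are inherited from the totient, a multiple of the Carmichael value.
  The lcm defining the latter still contains every p - 1, so the same key recovers p.\<close>

interpretation Carmichael: step_function Carmichael "\<lambda>p a. p ^ (a - 1) * (p - 1)" "\<lambda>p a. p - 1" False
proof
  fix m :: nat assume m: "m > 0"
  show "Carmichael m dvd (\<Prod>p\<in>prime_factors m. p ^ (multiplicity p m - 1) * (p - 1))"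
    using dvd_trans[OF Carmichael_dvd_totient totient.dvd_prod[OF m]] .
  have "Carmichael m \<le> totient m" using m by (intro dvd_imp_le Carmichael_dvd_totient) auto
  then show "real (Carmichael m) \<le> real m * (1 + ln (real m))"
    using m totient_le[of m] by (intro le_times_one_plus_ln) auto
  show "p - 1 dvd Carmichael m" if "p \<in> prime_factors m" for p
    using that by (rule minus_one_dvd_Carmichael)
qed (rule Carmichael_pos, fact totient.h_pos, fact totient.h_le, fact totient.h_1, fact totient.key_inj)

section \<open>Multiplicativity and size of the sum of divisors\<close>

lemma divisor_sigma_mult:
  assumes "coprime a b" "a > 0" "b > 0"
  shows "divisor_sigma (a * b) = divisor_sigma a * divisor_sigma b"
proof -
  have "bij_betw (\<lambda>(x, y). x * y) ({d. d dvd a} \<times> {d. d dvd b}) {d. d dvd a * b}"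
    unfolding bij_betw_def
  proof (intro conjI inj_onI equalityI subsetI)
    fix u v assume uv: "u \<in> {d. d dvd a} \<times> {d. d dvd b}" "v \<in> {d. d dvd a} \<times> {d. d dvd b}"
      and eq: "(case u of (x, y) \<Rightarrow> x * y) = (case v of (x, y) \<Rightarrow> x * y)"
    \<comment> \<open>Coprimality lets the factor x be recovered from the product xy, which gives
      injectivity.\<close>
    have fst: "gcd a (x * y) = x" if "x dvd a" "y dvd b" for x y
    proof -
      have "coprime a y" using assms(1) that(2) by (rule coprime_divisors[OF dvd_refl, rotated])
      then show ?thesis using that(1) by (simp add: gcd_mult_right_right_cancel gcd_nat.absorb2)
    qed
    obtain x y x' y' where [simp]: "u = (x, y)" "v = (x', y')" by (cases u, cases v)
    have "x = x'" using fst[of x y] fst[of x' y'] uv eq by simp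
    moreover have "x > 0" using uv assms by (auto intro: Nat.gr0I)
    ultimately show "u = v" using eq by simp
  next
    fix d assume "d \<in> {d. d dvd a * b}"
    then show "d \<in> (\<lambda>(x, y). x * y) ` ({d. d dvd a} \<times> {d. d dvd b})"
      using division_decomp[of d a b] by force
  qed (auto intro: mult_dvd_mono)
  from sum.reindex_bij_betw[OF this, of "\<lambda>x. x"] show ?thesis
    by (simp add: divisor_sigma_def sum_product sum.cartesian_product case_prod_unfold)
qed

lemma divisor_sigma_prod:
  assumes "finite A" "\<And>x. x \<in> A \<Longrightarrow> f x > 0" "\<And>x y. x \<in> A \<Longrightarrow> y \<in> A \<Longrightarrow> x \<noteq> y \<Longrightarrow> coprime (f x) (f y)"
  shows "divisor_sigma (prod f A) = (\<Prod>x\<in>A. divisor_sigma (f x))"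
  using assms
proof (induction A rule: finite_induct)
  case empty
  then show ?case by (simp add: divisor_sigma_def)
next
  case (insert x A)
  have "coprime (f x) (prod f A)" using insert by (intro prod_coprime_right) auto
  then show ?case using insert by (simp add: divisor_sigma_mult prod_pos)
qed

lemma divisor_sigma_prime_power:
  assumes "prime p"
  shows "divisor_sigma (p ^ a) = (\<Sum>i\<le>a. p ^ i)"
proof -
  have "{d. d dvd p ^ a} = (\<lambda>i. p ^ i) ` {..a}" using divides_primepow_nat[OF assms] by auto
  moreover have "inj_on (\<lambda>i. p ^ i) {..a}"
    using assms by (intro inj_onI) (rule prime_power_inj)
  ultimately show ?thesis by (simp add: divisor_sigma_def sum.reindex)
qed

lemma divisor_sigma_formula:
  assumes "m > 0"
  shows "divisor_sigma m = (\<Prod>p\<in>prime_factors m. \<Sum>i\<le>multiplicity p m. p ^ i)"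
proof -
  have "divisor_sigma m = divisor_sigma (\<Prod>p\<in>prime_factors m. p ^ multiplicity p m)"
    using assms by (simp flip: prime_factorization_nat)
  also have "\<dots> = (\<Prod>p\<in>prime_factors m. divisor_sigma (p ^ multiplicity p m))"
    by (intro divisor_sigma_prod) (auto intro!: primes_coprime coprime_power_left_iff[THEN iffD2] coprime_power_right_iff[THEN iffD2] simp: prime_gt_0_nat in_prime_factors_imp_prime)
  also have "\<dots> = (\<Prod>p\<in>prime_factors m. \<Sum>i\<le>multiplicity p m. p ^ i)"
    by (intro prod.cong refl divisor_sigma_prime_power) auto
  finally show ?thesis .
qed

text \<open>The involution d \<mapsto> m/d turns the sum into m times a sum of reciprocals, which is
  at most m times a harmonic number.\<close>

lemma divisor_sigma_le:
  assumes "m > 0"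
  shows "real (divisor_sigma m) \<le> real m * (1 + ln (real m))"
proof -
  let ?D = "{d. d dvd m}"
  have "bij_betw (\<lambda>d. m div d) ?D ?D"
    using assms by (intro bij_betwI[where g = "\<lambda>d. m div d"]) (auto elim!: dvdE)
  from sum.reindex_bij_betw[OF this, of real]
  have "real (divisor_sigma m) = (\<Sum>d\<in>?D. real (m div d))"
    by (simp add: divisor_sigma_def)
  also have "\<dots> = (\<Sum>d\<in>?D. real m * (1 / real d))"
    by (intro sum.cong) (auto simp: real_of_nat_div)
  also have "\<dots> \<le> (\<Sum>d=1..m. real m * (1 / real d))"
    using assms by (intro sum_mono2) (auto intro: dvd_imp_le Nat.gr0I simp: Suc_le_eq)
  also have "\<dots> = real m * harm m" by (simp add: harm_eq_sum sum_distrib_left)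
  also have "\<dots> \<le> real m * (1 + ln (real m))" using assms by (intro mult_left_mono harm_le_ln) auto
  finally show ?thesis .
qed

text \<open>The key has to be the full local factor: p + 1 need not divide the value when the
  exponent exceeds 1, as for m = 4 with value 7. For a fixed positive exponent this factor is
  strictly increasing in p.\<close>

interpretation sigma: step_function divisor_sigma "\<lambda>p a. \<Sum>i\<le>a. p ^ i" "\<lambda>p a. \<Sum>i\<le>a. p ^ i" True
proof
  fix m :: nat assume m: "m > 0"
  show "divisor_sigma m > 0"
    unfolding divisor_sigma_def by (rule sum_pos2[of _ 1]) (use m in \<open>auto simp: finite_divisors_nat\<close>)
next
  fix p a :: nat assume p: "prime p" "a > 0"
  show "(\<Sum>i\<le>a. p ^ i) > 0" by (rule sum_pos2[of _ 0]) auto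
  \<comment> \<open>The additional 1 makes the induction close, using only p \<ge> 2.\<close>
  have "(\<Sum>i\<le>a. p ^ i) + 1 \<le> p ^ Suc a"
  proof (induction a)
    case (Suc a)
    have "2 * p ^ Suc a \<le> p * p ^ Suc a" using prime_ge_2_nat[OF p(1)] by (rule mult_right_mono) simp
    also have "p * p ^ Suc a = p ^ Suc (Suc a)" by simp
    finally show ?case using Suc by (simp only: sum.atMost_Suc)
  qed (use prime_ge_2_nat[OF p(1)] in simp)
  then have "(\<Sum>i\<le>a. p ^ i) \<le> p ^ Suc a" by linarith
  also have "\<dots> \<le> p ^ (2 * a)" using p by (intro power_increasing) (auto simp: Suc_le_eq prime_gt_0_nat)
  finally show "(\<Sum>i\<le>a. p ^ i) \<le> p ^ (2 * a)" .
next
  fix a p q :: nat assume "a > 0" "prime p" "prime q" and eq: "(\<Sum>i\<le>a. p ^ i) = (\<Sum>i\<le>a. q ^ i)"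
  have less: "(\<Sum>i\<le>a. x ^ i) < (\<Sum>i\<le>a. y ^ i)" if "x < y" for x y :: nat
    using that \<open>a > 0\<close> by (intro sum_strict_mono_ex1) (auto intro!: power_mono bexI[of _ 1])
  show "p = q" using less[of p q] less[of q p] eq by (cases p q rule: linorder_cases) auto
next
  fix m :: nat assume m: "m > 0"
  show "divisor_sigma m dvd (\<Prod>p\<in>prime_factors m. \<Sum>i\<le>multiplicity p m. p ^ i)"
    using divisor_sigma_formula[OF m] by (simp only: dvd_refl)
  show "(\<Sum>i\<le>multiplicity p m. p ^ i) dvd divisor_sigma m" if "p \<in> prime_factors m" for p
    unfolding divisor_sigma_formula[OF m] using that by (intro dvd_prodI) auto
  show "real (divisor_sigma m) \<le> real m * (1 + ln (real m))" using m by (rule divisor_sigma_le)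
next
  fix p :: nat
  show "(\<Sum>i\<le>Suc 0. p ^ i) = shift True p" by (simp add: shift_def)
qed

section \<open>Tame functions\<close>

lemma card_multiples_le:
  assumes "d > 0"
  shows "real (card {n\<in>{1..x}. d dvd n}) \<le> real x / real d"
proof -
  have "inj_on (\<lambda>n. n div d) {n\<in>{1..x}. d dvd n}" by (auto simp: inj_on_def)
  moreover have "(\<lambda>n. n div d) ` {n\<in>{1..x}. d dvd n} \<subseteq> {1..x div d}"
  proof (rule image_subsetI)
    fix n assume "n \<in> {n\<in>{1..x}. d dvd n}"
    then have "d \<le> n" "n \<le> x" by (auto dest: dvd_imp_le)
    then show "n div d \<in> {1..x div d}"
      using assms div_le_mono[of n x d] by (auto simp: Suc_le_eq div_greater_zero_iff)
  qed
  ultimately have "card {n\<in>{1..x}. d dvd n} \<le> card {1..x div d}" by (intro card_inj_on_le) auto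
  also have "\<dots> = x div d" by simp
  finally have "real (card {n\<in>{1..x}. d dvd n}) \<le> real (x div d)" by simp
  also have "\<dots> \<le> real x / real d" by (rule of_nat_div_le_of_nat)
  finally show ?thesis .
qed

text \<open>The bound \<open>x / ln x ^ 2\<close> for the exceptional set makes it negligible even among the primes.\<close>

definition tame :: "(nat \<Rightarrow> nat) \<Rightarrow> bool" where
  "tame f \<longleftrightarrow> (\<exists>e. \<forall>\<^sub>F x :: nat in sequentially. \<exists>G \<subseteq> {1..x}.
     controlled f G (nat \<lfloor>x * ln x ^ e\<rfloor>) (nat \<lfloor>ln (ln x) ^ e\<rfloor>)
       (exp (ln (ln x) ^ e)) (x * ln x ^ e) (exp (ln (ln x) ^ e)) \<and>
     real (card ({1..x} - G)) \<le> e * (x / ln x ^ 2))"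

text \<open>Exponent 3 exceeds the order (ln (ln x))^2 of the bound on prime factors for S = (ln
  x)^5, with 1 to spare for the floor. This S leaves a saving of (ln x)^3 after the loss of (ln
  x)^2. Large square divisors cost 2x/T, which is smaller than x over any power of ln x.\<close>

lemma tame_id: "tame id"
  unfolding tame_def
proof (intro exI[of _ 3])
  have E1: "\<forall>\<^sub>F x :: nat in sequentially. ln (ln x) ^ 3 \<ge> 3 * (log 2 (ln x ^ 5))\<^sup>2 + 1" by real_asymp
  have E2: "\<forall>\<^sub>F x :: nat in sequentially. real x \<le> x * ln x ^ 3 - 1" by real_asymp
  have E3: "\<forall>\<^sub>F x :: nat in sequentially. x * (((1 + ln x)\<^sup>2 + 2 * (1 + ln x)) / ln x ^ 5) + x * (2 / exp (ln (ln x) ^ 3)) \<le> 3 * (x / ln x ^ 2)"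
    by real_asymp
  have E4: "\<forall>\<^sub>F x :: nat in sequentially. ln (ln x) ^ 3 \<ge> 1" by real_asymp
  have E5: "\<forall>\<^sub>F x :: nat in sequentially. ln x ^ 5 \<ge> 2" by real_asymp
  show "\<forall>\<^sub>F x :: nat in sequentially. \<exists>G \<subseteq> {1..x}.
     controlled id G (nat \<lfloor>x * ln x ^ 3\<rfloor>) (nat \<lfloor>ln (ln x) ^ 3\<rfloor>)
       (exp (ln (ln x) ^ 3)) (x * ln x ^ 3) (exp (ln (ln x) ^ 3)) \<and>
     real (card ({1..x} - G)) \<le> real 3 * (x / ln x ^ 2)"
    using E1 E2 E3 E4 E5 eventually_gt_at_top[of 0]
  proof eventually_elim
    case (elim x)
    define T where "T = exp (ln (ln x) ^ 3)"
    define V where "V = nat \<lfloor>ln (ln x) ^ 3\<rfloor>"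
    define bad1 where "bad1 = {n. n \<in> {1..x} \<and> real V < real (Omega n)}"
    define bad2 where "bad2 = {n\<in>{1..x}. \<exists>q. prime q \<and> T < real q \<and> q\<^sup>2 dvd n}"
    define G where "G = {1..x} - (bad1 \<union> bad2)"
    have "0 \<le> ln (ln x) ^ 3" using elim(4) by linarith
    then have T: "T \<ge> 1" by (simp only: T_def one_le_exp_iff)
    have V: "real V \<ge> 3 * (log 2 (ln x ^ 5))\<^sup>2" using elim(1) unfolding V_def by linarith
    have Y: "real x \<le> x * ln x ^ 3" using elim(2) by simp
    have mult: "real (card {n\<in>G. d dvd n}) \<le> x * ln x ^ 3 / real d" if "d > 0" for d
    proof -
      have "card {n\<in>G. d dvd n} \<le> card {n\<in>{1..x}. d dvd n}" by (intro card_mono) (auto simp: G_def)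
      then have "real (card {n\<in>G. d dvd n}) \<le> real x / real d" using card_multiples_le[OF that, of x] by linarith
      also have "\<dots> \<le> x * ln x ^ 3 / real d" using Y by (intro divide_right_mono) auto
      finally show ?thesis .
    qed
    have "controlled id G (nat \<lfloor>x * ln x ^ 3\<rfloor>) V T (x * ln x ^ 3) T"
      unfolding controlled_def
    proof (intro conjI ballI allI impI)
      fix n assume n: "n \<in> G"
      then show "0 < id n" "Omega (id n) \<le> V" by (auto simp: G_def bad1_def)
      show "\<not> q\<^sup>2 dvd id n" if "prime q \<and> T < real q" for q
        using n that by (auto simp: G_def bad2_def)
      have "real n \<le> real x" using n by (simp add: G_def)
      then have "real n \<le> x * ln x ^ 3" using Y by (rule order_trans)
      then show "id n \<le> nat \<lfloor>x * ln x ^ 3\<rfloor>" by (simp add: le_nat_floor)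
    next
      fix m
      have "card {n\<in>G. id n = m} \<le> card {m}" by (intro card_mono) auto
      then show "real (card {n\<in>G. id n = m}) \<le> T" using T by simp
    next
      fix q q' assume "prime q \<and> prime q' \<and> T < real q \<and> T < real q'"
      then show "real (card {n\<in>G. q * q' dvd id n}) \<le> x * ln x ^ 3 / (real q * real q')"
        using mult[of "q * q'"] by (simp add: prime_gt_0_nat)
    next
      fix q assume "prime q \<and> T < real q"
      then show "real (card {n\<in>G. q dvd id n}) \<le> x * ln x ^ 3 / real q"
        using mult[of q] by (simp add: prime_gt_0_nat)
    qed (simp add: G_def)
    moreover have "real (card ({1..x} - G)) \<le> 3 * (x / ln x ^ 2)"
    proof -
      have "real (card bad1) = (\<Sum>n\<in>bad1. 1)" by simp
      also have "\<dots> \<le> (\<Sum>n\<in>bad1. x * (1 / real n))" by (intro sum_mono) (auto simp: bad1_def)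
      also have "\<dots> = x * (\<Sum>n\<in>bad1. 1 / real n)" by (simp add: sum_distrib_left)
      also have "\<dots> \<le> x * (((harm x)\<^sup>2 + 2 * harm x) / ln x ^ 5)"
        unfolding bad1_def using elim V by (intro mult_left_mono sum_many_prime_factors_le) auto
      also have "\<dots> \<le> x * (((1 + ln x)\<^sup>2 + 2 * (1 + ln x)) / ln x ^ 5)"
        using elim harm_le_ln[of x] harm_nonneg[of x, where 'a = real]
        by (intro mult_left_mono divide_right_mono add_mono power_mono) auto
      finally have b1: "real (card bad1) \<le> x * (((1 + ln x)\<^sup>2 + 2 * (1 + ln x)) / ln x ^ 5)" .
      have "real (card bad2) \<le> (\<Sum>q | q \<in> {1..x} \<and> T < real q. real x / real (q\<^sup>2))"
      proof (rule card_Union_le_sum[where B = "\<lambda>q. {n\<in>{1..x}. q\<^sup>2 dvd n}"])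
        show "bad2 \<subseteq> (\<Union>q\<in>{q. q \<in> {1..x} \<and> T < real q}. {n\<in>{1..x}. q\<^sup>2 dvd n})"
        proof
          fix n assume "n \<in> bad2"
          then obtain q where q: "n \<in> {1..x}" "prime q" "T < real q" "q\<^sup>2 dvd n" by (auto simp: bad2_def)
          have "q dvd n" using q(4) by (simp add: power2_eq_square dvd_mult_left)
          then have "q \<le> n" using q(1) by (intro dvd_imp_le) auto
          then show "n \<in> (\<Union>q\<in>{q. q \<in> {1..x} \<and> T < real q}. {n\<in>{1..x}. q\<^sup>2 dvd n})"
            using q prime_gt_0_nat[OF q(2)] by (auto simp: Suc_le_eq)
        qed
        show "real (card {n\<in>{1..x}. q\<^sup>2 dvd n}) \<le> real x / real (q\<^sup>2)"
          if "q \<in> {q. q \<in> {1..x} \<and> T < real q}" for q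
          using that by (intro card_multiples_le) auto
      qed auto
      also have "\<dots> = x * (\<Sum>q | q \<in> {1..x} \<and> T < real q. 1 / (real q)\<^sup>2)"
        by (simp add: sum_distrib_left)
      also have "\<dots> \<le> x * (2 / T)" using T by (intro mult_left_mono sum_inverse_squares_le) auto
      finally have b2: "real (card bad2) \<le> x * (2 / T)" .
      have "card ({1..x} - G) \<le> card (bad1 \<union> bad2)" by (intro card_mono) (auto simp: G_def bad1_def bad2_def)
      also have "\<dots> \<le> card bad1 + card bad2" by (rule card_Un_le)
      finally have "real (card ({1..x} - G)) \<le> real (card bad1) + real (card bad2)" by linarith
      then show ?thesis using b1 b2 elim(3) unfolding T_def by linarith
    qed
    moreover have "G \<subseteq> {1..x}" by (auto simp: G_def)
    ultimately have "G \<subseteq> {1..x} \<and> controlled id G (nat \<lfloor>x * ln x ^ 3\<rfloor>) V T (x * ln x ^ 3) T \<and>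
        real (card ({1..x} - G)) \<le> 3 * (x / ln x ^ 2)" by (intro conjI)
    then show ?case unfolding T_def V_def of_nat_numeral by (rule exI)
  qed
qed

text \<open>With L = ln x and u = ln L, one step is taken with A = L^2 and S = L^(e+7). The fibre
  bound is the most expensive quantity: its exponent is of order V^2 v, about u^(4e+3), which
  explains 4e in the new exponent. The summand 10 leaves room for all lower-order terms and
  constants.\<close>

lemma (in step_function) tame_comp:
  assumes "tame f"
  shows "tame (\<phi> \<circ> f)"
proof -
  obtain e where ev: "\<forall>\<^sub>F x :: nat in sequentially. \<exists>G \<subseteq> {1..x}.
     controlled f G (nat \<lfloor>x * ln x ^ e\<rfloor>) (nat \<lfloor>ln (ln x) ^ e\<rfloor>)
       (exp (ln (ln x) ^ e)) (x * ln x ^ e) (exp (ln (ln x) ^ e)) \<and>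
     real (card ({1..x} - G)) \<le> e * (x / ln x ^ 2)"
    using assms unfolding tame_def by blast
  have E1: "\<forall>\<^sub>F x :: nat in sequentially. 2 * ln (ln x) ^ e * ln (ln x) ^ e \<le> ln (ln x) ^ (2 * e + 3) * ln 2"
    by real_asymp
  have E2: "\<forall>\<^sub>F x :: nat in sequentially. (x * ln x ^ e) * (1 + ln (x * ln x ^ e)) \<le> x * ln x ^ (e + 2)"
    by real_asymp
  have E3: "\<forall>\<^sub>F x :: nat in sequentially. ln x ^ (e + 7) \<ge> 2" by real_asymp
  have E4: "\<forall>\<^sub>F x :: nat in sequentially. 3 * (log 2 (ln x ^ (e + 7)))\<^sup>2 \<le> ln (ln x) ^ (2 * e + 3)" by real_asymp
  have E5: "\<forall>\<^sub>F x :: nat in sequentially. 2 * (1 + ln (x * ln x ^ e + 1)) \<le> ln x ^ 2" by real_asymp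
  have E6: "\<forall>\<^sub>F x :: nat in sequentially. ln x ^ 2 \<ge> 1" by real_asymp
  have E7: "\<forall>\<^sub>F x :: nat in sequentially. ln (ln x) ^ e * (ln (ln x) ^ (2 * e + 3) + 1) \<le> ln (ln x) ^ (4 * e + 10)"
    by real_asymp
  have E8: "\<forall>\<^sub>F x :: nat in sequentially. ln (ln x) ^ (2 * e + 3) + 1 \<le> ln (ln x) ^ (4 * e + 10)"
    by real_asymp
  have E9: "\<forall>\<^sub>F x :: nat in sequentially. 2 * (ln x ^ 2)\<^sup>2 * (x * ln x ^ e) \<le> x * ln x ^ (4 * e + 10)"
    by real_asymp
  have E10: "\<forall>\<^sub>F x :: nat in sequentially.
      ln (ln x) ^ e + ln (ln x) ^ e * ln (ln x) ^ e * (ln (ln x) ^ (2 * e + 3) + 2) \<le> ln (ln x) ^ (4 * e + 10)"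
    by real_asymp
  \<comment> \<open>Here K A^2 / S = x L^e L^4 / L^(e+7) = x / L^3, while 2^v exceeds every power of
    L.\<close>
  have E11: "\<forall>\<^sub>F x :: nat in sequentially. 2 * (x * ln x ^ e) * (ln x ^ 2)\<^sup>2 / ln x ^ (e + 7)
      + 4 * (ln x ^ 2)\<^sup>2 * (x * ln x ^ e) / exp (ln (ln x) ^ (2 * e + 3) * ln 2) \<le> x / ln x ^ 2"
    by real_asymp
  have E12: "\<forall>\<^sub>F x :: nat in sequentially. ln (ln x) \<ge> 1" by real_asymp
  have E13: "\<forall>\<^sub>F x :: nat in sequentially. x * ln x ^ (e + 2) \<le> x * ln x ^ (4 * e + 10)" by real_asymp
  have E14: "\<forall>\<^sub>F x :: nat in sequentially. ln x \<ge> 1" by real_asymp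
  have "\<forall>\<^sub>F x :: nat in sequentially. \<exists>G \<subseteq> {1..x}.
     controlled (\<phi> \<circ> f) G (nat \<lfloor>x * ln x ^ (4 * e + 10)\<rfloor>) (nat \<lfloor>ln (ln x) ^ (4 * e + 10)\<rfloor>)
       (exp (ln (ln x) ^ (4 * e + 10))) (x * ln x ^ (4 * e + 10)) (exp (ln (ln x) ^ (4 * e + 10))) \<and>
     real (card ({1..x} - G)) \<le> real (4 * e + 10) * (x / ln x ^ 2)"
    using ev E1 E2 E3 E4 E5 E6 E7 E8 E9 E10 E11 E12 E13 E14 eventually_gt_at_top[of 0]
  proof eventually_elim
    case (elim x)
    define L where "L = ln (real x)"
    define u where "u = ln L"
    define V where "V = nat \<lfloor>u ^ e\<rfloor>"
    \<comment> \<open>T^(2V) = exp (2 V u^e) is at most exp (2 u^(2e)), so a number of bits slightly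
      above the order u^(2e) is needed. The surplus 3 also covers the order u^2 required by
      \<open>S\<close>, even when e = 0.\<close>
    define v where "v = nat \<lceil>u ^ (2 * e + 3)\<rceil>"
    define Y where "Y = nat \<lfloor>x * L ^ e\<rfloor>"
    define Y' where "Y' = nat \<lfloor>x * L ^ (e + 2)\<rfloor>"
    note elim = elim[folded L_def, folded u_def]
    have u: "u \<ge> 1" and L: "L \<ge> 1" and x: "x > 0" using elim by auto
    obtain G where G: "G \<subseteq> {1..x}" "controlled f G Y V (exp (u ^ e)) (x * L ^ e) (exp (u ^ e))"
      "real (card ({1..x} - G)) \<le> e * (x / L ^ 2)"
      using elim(1) unfolding Y_def V_def by blast
    have V: "real V \<le> u ^ e" using u by (simp add: V_def)
    have v: "u ^ (2 * e + 3) \<le> real v" "real v \<le> u ^ (2 * e + 3) + 1" using u by (simp_all add: v_def)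
    have Yr: "real Y \<le> x * L ^ e" using L by (simp add: Y_def)
    have pow2: "exp (u ^ (2 * e + 3) * ln 2) \<le> 2 ^ v"
    proof -
      have "exp (u ^ (2 * e + 3) * ln 2) \<le> exp (real v * ln 2)" using v by simp
      then show ?thesis by (simp add: exp_of_nat_mult)
    qed
    have "\<exists>G' \<subseteq> G. controlled (\<phi> \<circ> f) G' Y' (V * v) (2 ^ v) (2 * (L ^ 2)\<^sup>2 * (x * L ^ e))
        (exp (u ^ e) * (real V * 2 ^ (V * v) + 1) ^ V)
      \<and> real (card (G - G')) \<le> 2 * (x * L ^ e) * (L ^ 2)\<^sup>2 / L ^ (e + 7) + 4 * (L ^ 2)\<^sup>2 * (x * L ^ e) / 2 ^ v"
    proof (rule controlled_step[OF G(2)])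
      have "exp (u ^ e) ^ (2 * V) = exp (2 * real V * u ^ e)"
        by (simp flip: exp_of_nat_mult)
      also have "\<dots> \<le> exp (u ^ (2 * e + 3) * ln 2)"
      proof -
        have "2 * real V * u ^ e \<le> 2 * u ^ e * u ^ e" using V u by (intro mult_right_mono mult_left_mono) auto
        then show ?thesis using elim(2) by simp
      qed
      also note pow2
      finally show "exp (u ^ e) ^ (2 * V) \<le> 2 ^ v" .
      show "real x * L ^ e \<ge> 0" using L by simp
      show "L ^ (e + 7) \<ge> 2" using elim by simp
      show "real v \<ge> 3 * (log 2 (L ^ (e + 7)))\<^sup>2" using elim(5) v by linarith
      show "L ^ 2 \<ge> 1" using elim by simp
      have "2 * harm (Y + 1) \<le> 2 * (1 + ln (real (Y + 1)))" using harm_le_ln[of "Y + 1"] by simp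
      also have "\<dots> \<le> 2 * (1 + ln (x * L ^ e + 1))" using Yr by (intro mult_left_mono add_left_mono ln_mono) auto
      also have "\<dots> \<le> L ^ 2" by (rule elim(6))
      finally show "2 * harm (Y + 1) \<le> L ^ 2" .
      fix m assume m: "0 < m" "m \<le> Y"
      then have mr: "real m \<le> x * L ^ e" using Yr by (meson of_nat_le_iff order_trans)
      have "real (\<phi> m) \<le> real m * (1 + ln (real m))" by (rule upper[OF m(1)])
      also have "\<dots> \<le> (x * L ^ e) * (1 + ln (x * L ^ e))"
        using mr m by (intro mult_mono add_left_mono ln_mono) auto
      also have "\<dots> \<le> x * L ^ (e + 2)" by (rule elim(3))
      finally show "\<phi> m \<le> Y'" by (simp add: Y'_def le_nat_floor)
    qed
    then obtain G' where G': "G' \<subseteq> G" and ctrl: "controlled (\<phi> \<circ> f) G' Y' (V * v) (2 ^ v)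
        (2 * (L ^ 2)\<^sup>2 * (x * L ^ e)) (exp (u ^ e) * (real V * 2 ^ (V * v) + 1) ^ V)"
      and card: "real (card (G - G')) \<le> 2 * (x * L ^ e) * (L ^ 2)\<^sup>2 / L ^ (e + 7) + 4 * (L ^ 2)\<^sup>2 * (x * L ^ e) / 2 ^ v"
      by blast
    have "controlled (\<phi> \<circ> f) G' (nat \<lfloor>x * L ^ (4 * e + 10)\<rfloor>) (nat \<lfloor>u ^ (4 * e + 10)\<rfloor>)
       (exp (u ^ (4 * e + 10))) (x * L ^ (4 * e + 10)) (exp (u ^ (4 * e + 10)))"
    proof (rule controlled_mono[OF ctrl])
      show "Y' \<le> nat \<lfloor>x * L ^ (4 * e + 10)\<rfloor>"
        unfolding Y'_def using elim(14) by (intro nat_mono floor_mono)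
      have "real (V * v) \<le> u ^ e * (u ^ (2 * e + 3) + 1)"
        using V v u by (simp only: of_nat_mult) (intro mult_mono, auto)
      also have "\<dots> \<le> u ^ (4 * e + 10)" by (rule elim(8))
      finally show "V * v \<le> nat \<lfloor>u ^ (4 * e + 10)\<rfloor>" by (simp add: le_nat_floor del: of_nat_mult)
      have two: "(2::real) ^ n \<le> exp (real n)" for n
        using power_mono[of 2 "exp (1::real)" n] exp_ge_add_one_self[of 1] by (simp flip: exp_of_nat_mult)
      have "real v \<le> u ^ (4 * e + 10)" using v elim(9) by linarith
      then have "exp (real v) \<le> exp (u ^ (4 * e + 10))" by simp
      with two[of v] show "2 ^ v \<le> exp (u ^ (4 * e + 10))" by (rule order_trans)
      show "2 * (L ^ 2)\<^sup>2 * (x * L ^ e) \<le> x * L ^ (4 * e + 10)" by (rule elim(10))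
      have "real V * 2 ^ (V * v) + 1 \<le> (real V + 1) * 2 ^ (V * v)" by (simp add: algebra_simps)
      also have "\<dots> \<le> exp (real V) * exp (real (V * v))"
        using exp_ge_add_one_self[of "real V"] by (intro mult_mono two) (auto simp: add.commute)
      finally have "(real V * 2 ^ (V * v) + 1) ^ V \<le> (exp (real V) * exp (real (V * v))) ^ V"
        by (intro power_mono) auto
      also have "\<dots> = exp (real V * (real V + real V * real v))"
        by (simp add: exp_add exp_of_nat_mult)
      finally have "exp (u ^ e) * (real V * 2 ^ (V * v) + 1) ^ V \<le> exp (u ^ e + real V * (real V + real V * real v))"
        by (simp add: exp_add)
      also have "u ^ e + real V * (real V + real V * real v) = u ^ e + real V * real V * (real v + 1)"
        by (simp add: algebra_simps)
      also have "exp \<dots> \<le> exp (u ^ e + u ^ e * u ^ e * (u ^ (2 * e + 3) + 2))"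
        using V v u by (simp only: exp_le_cancel_iff, intro add_left_mono mult_mono) auto
      also have "\<dots> \<le> exp (u ^ (4 * e + 10))" using elim(11) by simp
      finally show "exp (u ^ e) * (real V * 2 ^ (V * v) + 1) ^ V \<le> exp (u ^ (4 * e + 10))" .
    qed
    moreover have "real (card ({1..x} - G')) \<le> real (4 * e + 10) * (x / L ^ 2)"
    proof -
      have "{1..x} - G' = ({1..x} - G) \<union> (G - G')" using G(1) G' by blast
      then have "card ({1..x} - G') \<le> card ({1..x} - G) + card (G - G')" by (simp add: card_Un_le)
      then have "real (card ({1..x} - G')) \<le> real (card ({1..x} - G)) + real (card (G - G'))" by linarith
      also have "real (card (G - G')) \<le> x / L ^ 2"
      proof -
        have "4 * (L ^ 2)\<^sup>2 * (x * L ^ e) / 2 ^ v \<le> 4 * (L ^ 2)\<^sup>2 * (x * L ^ e) / exp (u ^ (2 * e + 3) * ln 2)"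
          using pow2 L by (intro divide_left_mono) auto
        then show ?thesis using card elim(12) by linarith
      qed
      also have "real (card ({1..x} - G)) \<le> e * (x / L ^ 2)" by (rule G(3))
      also have "e * (x / L ^ 2) + x / L ^ 2 = (real e + 1) * (x / L ^ 2)" by (simp only: distrib_right mult_1)
      also have "\<dots> \<le> real (4 * e + 10) * (x / L ^ 2)" by (intro mult_right_mono) auto
      finally show ?thesis by simp
    qed
    ultimately show ?case unfolding L_def[symmetric] u_def[symmetric] using G(1) G' by blast
  qed
  then show ?thesis unfolding tame_def by blast
qed

lemma tame_foldr:
  assumes "set fs \<subseteq> {totient, divisor_sigma, Carmichael}"
  shows "tame (foldr (\<circ>) fs id)"
  using assms
proof (induction fs)
  case (Cons \<phi> fs)
  have "set fs \<subseteq> {totient, divisor_sigma, Carmichael}" using Cons.prems by simp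
  then have "tame (foldr (\<circ>) fs id)" by (rule Cons.IH)
  moreover have "foldr (\<circ>) (\<phi> # fs) id = \<phi> \<circ> foldr (\<circ>) fs id" by (simp only: foldr.simps o_apply)
  moreover have "\<phi> = totient \<or> \<phi> = divisor_sigma \<or> \<phi> = Carmichael" using Cons.prems by auto
  ultimately show ?case
    using totient.tame_comp Carmichael.tame_comp sigma.tame_comp by metis
qed (simp add: tame_id)

lemma positive_foldr:
  assumes "set fs \<subseteq> {totient, divisor_sigma, Carmichael}" "n > 0"
  shows "foldr (\<circ>) fs id n > 0"
  using assms
proof (induction fs)
  case (Cons \<phi> fs)
  then show ?case using totient.pos Carmichael.pos sigma.pos by auto
qed simp

text \<open>Tameness bounds the values only on the good set. This bound holds for every n and limits
  the lengths of the blocks at exceptional arguments and of the unfinished block.\<close>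

lemma upper_foldr:
  assumes "set fs \<subseteq> {totient, divisor_sigma, Carmichael}"
  shows "\<exists>e. \<forall>\<^sub>F x :: nat in sequentially. \<forall>n\<in>{1..x}. real (foldr (\<circ>) fs id n) \<le> x * ln x ^ e"
  using assms
proof (induction fs)
  case Nil
  show ?case by (intro exI[of _ 0] always_eventually) auto
next
  case (Cons \<phi> fs)
  have "set fs \<subseteq> {totient, divisor_sigma, Carmichael}" using Cons.prems by simp
  then obtain e where ev: "\<forall>\<^sub>F x :: nat in sequentially. \<forall>n\<in>{1..x}. real (foldr (\<circ>) fs id n) \<le> x * ln x ^ e"
    using Cons.IH by blast
  have E: "\<forall>\<^sub>F x :: nat in sequentially. (x * ln x ^ e) * (1 + ln (x * ln x ^ e)) \<le> x * ln x ^ (e + 2)"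
    by real_asymp
  have "\<forall>\<^sub>F x :: nat in sequentially. \<forall>n\<in>{1..x}. real (foldr (\<circ>) (\<phi> # fs) id n) \<le> x * ln x ^ (e + 2)"
    using ev E
  proof eventually_elim
    case (elim x)
    show ?case
    proof
      fix n assume n: "n \<in> {1..x}"
      define m where "m = foldr (\<circ>) fs id n"
      have m: "m > 0" using positive_foldr[of fs n] Cons.prems n by (simp add: m_def)
      have mr: "real m \<le> x * ln x ^ e" using elim(1) n by (simp add: m_def)
      have "real (\<phi> m) \<le> real m * (1 + ln (real m))"
        using Cons.prems totient.upper[OF m] Carmichael.upper[OF m] sigma.upper[OF m] by auto
      also have "\<dots> \<le> (x * ln x ^ e) * (1 + ln (x * ln x ^ e))"
        using mr m by (intro mult_mono add_left_mono ln_mono) auto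
      also have "\<dots> \<le> x * ln x ^ (e + 2)" by (rule elim(2))
      finally show "real (foldr (\<circ>) (\<phi> # fs) id n) \<le> x * ln x ^ (e + 2)" by (simp add: m_def)
    qed
  qed
  then show ?case by blast
qed

section \<open>Chebyshev's lower bound for the number of primes\<close>

text \<open>Legendre's formula, from ln n = sum of \<open>mangoldt d\<close> over d dividing n by
  counting multiples of each d.\<close>

lemma sum_mangoldt_floor:
  "ln (fact N) = (\<Sum>d=1..N. mangoldt d * real (N div d))"
proof -
  have "ln (fact N :: real) = (\<Sum>n=1..N. ln (real n))"
    unfolding fact_prod of_nat_prod by (subst ln_prod) auto
  also have "\<dots> = (\<Sum>n=1..N. \<Sum>d | d \<in> {1..N} \<and> d dvd n. mangoldt d)"
  proof (intro sum.cong refl)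
    fix n assume n: "n \<in> {1..N}"
    then have "ln (real n) = (\<Sum>d | d dvd n. mangoldt d)" using mangoldt_sum[of n, where 'a = real] by simp
    also have "{d. d dvd n} = {d. d \<in> {1..N} \<and> d dvd n}"
      using n by (auto dest: dvd_imp_le intro: Nat.gr0I simp: Suc_le_eq)
    finally show "ln (real n) = (\<Sum>d | d \<in> {1..N} \<and> d dvd n. mangoldt d)" .
  qed
  also have "\<dots> = (\<Sum>d=1..N. \<Sum>n | n \<in> {1..N} \<and> d dvd n. mangoldt d)"
    by (rule sum.swap_restrict) auto
  also have "\<dots> = (\<Sum>d=1..N. mangoldt d * real (N div d))"
  proof (intro sum.cong refl)
    fix d assume d: "d \<in> {1..N}"
    have "card {n. n \<in> {1..N} \<and> d dvd n} = card {1..N div d}"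
    proof (rule bij_betw_same_card[OF bij_betwI[where f = "\<lambda>n. n div d" and g = "\<lambda>k. k * d"]])
      show "(\<lambda>n. n div d) \<in> {n. n \<in> {1..N} \<and> d dvd n} \<rightarrow> {1..N div d}"
      proof
        fix n assume "n \<in> {n. n \<in> {1..N} \<and> d dvd n}"
        then have "d \<le> n" "n \<le> N" by (auto dest: dvd_imp_le)
        then show "n div d \<in> {1..N div d}"
          using d div_le_mono[of n N d] by (auto simp: Suc_le_eq div_greater_zero_iff)
      qed
      show "(\<lambda>k. k * d) \<in> {1..N div d} \<rightarrow> {n. n \<in> {1..N} \<and> d dvd n}"
        using d by (auto simp: less_eq_div_iff_mult_less_eq Suc_le_eq)
    qed (use d in auto)
    then show "(\<Sum>n | n \<in> {1..N} \<and> d dvd n. mangoldt d) = mangoldt d * real (N div d)" by simp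
  qed
  finally show ?thesis .
qed

text \<open>A prime p has at most ln N / ln p powers up to N, each of weight ln p, so it contributes
  at most ln N in total.\<close>

lemma sum_mangoldt_le:
  "(\<Sum>d=1..N. mangoldt d) \<le> real (card {p. prime p \<and> p \<le> N}) * ln (real N)"
proof (cases "N = 0")
  case False
  define P where "P = {p. prime p \<and> p \<le> N}"
  define k where "k = (\<lambda>p::nat. nat \<lfloor>log (real p) (real N)\<rfloor>)"
  have finP: "finite P" by (rule finite_subset[of _ "{..N}"]) (auto simp: P_def)
  have P: "p > 1" if "p \<in> P" for p using that prime_gt_1_nat by (auto simp: P_def)
  have "(\<Sum>d=1..N. mangoldt d) = (\<Sum>d | d \<in> {1..N} \<and> primepow d. mangoldt d)"
    by (intro sum.mono_neutral_right) (auto simp: mangoldt_def)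
  also have "\<dots> \<le> (\<Sum>(p, i)\<in>(SIGMA p:P. {1..k p}). ln (real p))"
  proof (rule sum_le_included[where i = "\<lambda>(p, i). p ^ i"])
    show "\<forall>d\<in>{d. d \<in> {1..N} \<and> primepow d}. \<exists>y\<in>(SIGMA p:P. {1..k p}). (case y of (p, i) \<Rightarrow> p ^ i) = d \<and>
        mangoldt d \<le> (case y of (p, i) \<Rightarrow> ln (real p))"
    proof
      fix d assume d: "d \<in> {d. d \<in> {1..N} \<and> primepow d}"
      then obtain p i where pi: "prime p" "i > 0" "d = p ^ i" by (auto simp: primepow_def)
      have p: "p > 1" using prime_gt_1_nat[OF pi(1)] .
      have "p \<le> p ^ i" using pi p by (intro self_le_power) auto
      then have "p \<in> P" using pi d by (simp add: P_def)
      moreover have "real i \<le> log (real p) (real N)"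
      proof -
        have "real p powr real i \<le> real N" using d p pi by (simp add: powr_realpow flip: of_nat_power)
        then show ?thesis using p False by (subst le_log_iff) auto
      qed
      then have "i \<le> k p" by (simp add: k_def le_nat_floor)
      ultimately show "\<exists>y\<in>(SIGMA p:P. {1..k p}). (case y of (p, i) \<Rightarrow> p ^ i) = d \<and>
          mangoldt d \<le> (case y of (p, i) \<Rightarrow> ln (real p))"
        using pi by (intro bexI[of _ "(p, i)"]) auto
    qed
  qed (use P finP in \<open>auto simp: case_prod_unfold dest!: P\<close>)
  also have "\<dots> = (\<Sum>p\<in>P. real (k p) * ln (real p))"
    using finP by (subst sum.Sigma[symmetric]) auto
  also have "\<dots> \<le> (\<Sum>p\<in>P. ln (real N))"
  proof (rule sum_mono)
    fix p assume p: "p \<in> P"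
    have "log (real p) (real N) \<ge> 0" using P[OF p] False by (simp add: log_def)
    then have "real (k p) \<le> log (real p) (real N)" by (simp add: k_def)
    then have "real (k p) * ln (real p) \<le> log (real p) (real N) * ln (real p)"
      using P[OF p] by (intro mult_right_mono) auto
    also have "\<dots> = ln (real N)" using P[OF p] by (simp add: log_def)
    finally show "real (k p) * ln (real p) \<le> ln (real N)" .
  qed
  finally show ?thesis by (simp add: P_def)
qed simp

text \<open>Chebyshev's argument: \<open>\<lfloor>2N/d\<rfloor> - 2\<lfloor>N/d\<rfloor> \<le> 1\<close> bounds \<open>ln (2N choose N)\<close> by
  \<open>\<Sum>d\<le>2N. mangoldt d\<close>.\<close>

lemma card_primes_ge:
  assumes "N > 0"
  shows "real N * ln 2 \<le> real (card {p. prime p \<and> p \<le> 2 * N}) * ln (real (2 * N))"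
proof -
  \<comment> \<open>A weak bound for the central binomial coefficient; any exponential lower bound
    gives the right order of magnitude.\<close>
  have "real (2 ^ N) \<le> real ((2 * N) choose N)"
  proof -
    have "(real (2 * N) / real N) ^ N \<le> real ((2 * N) choose N)"
      by (rule binomial_ge_n_over_k_pow_k) simp
    moreover have "real (2 * N) / real N = 2" using assms by simp
    ultimately show ?thesis by simp
  qed
  then have "ln (real (2 ^ N)) \<le> ln (real ((2 * N) choose N))" by (intro ln_mono) auto
  then have "real N * ln 2 \<le> ln (real ((2 * N) choose N))" by (simp add: ln_realpow)
  also have "\<dots> = ln (fact (2 * N)) - 2 * ln (fact N)"
  proof -
    have "2 * N - N = N" by simp
    then have "real ((2 * N) choose N) = fact (2 * N) / (fact N * fact N)"
      using binomial_fact[of N "2 * N", where 'a = real] by simp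
    then show ?thesis by (simp add: ln_div ln_mult)
  qed
  also have "\<dots> = (\<Sum>d=1..2*N. mangoldt d * real (2 * N div d)) - 2 * (\<Sum>d=1..2*N. mangoldt d * real (N div d))"
  proof -
    \<comment> \<open>The terms with d > N vanish, so both sums can run up to 2N.\<close>
    have "(\<Sum>d=1..N. mangoldt d * real (N div d)) = (\<Sum>d=1..2*N. mangoldt d * real (N div d))"
      by (intro sum.mono_neutral_left) auto
    then show ?thesis by (simp add: sum_mangoldt_floor)
  qed
  also have "\<dots> = (\<Sum>d=1..2*N. mangoldt d * (real (2 * N div d) - 2 * real (N div d)))"
    by (simp add: sum_distrib_left sum_subtractf algebra_simps)
  also have "\<dots> \<le> (\<Sum>d=1..2*N. mangoldt d * 1)"
  proof (intro sum_mono mult_left_mono mangoldt_nonneg)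
    fix d assume d: "d \<in> {1..2*N}"
    have "N < d + (N div d) * d" using d by (intro dividend_less_div_times) auto
    then have "2 * N < (2 * (N div d) + 2) * d" by (simp only: distrib_right mult_2)
    then have "2 * N div d < 2 * (N div d) + 2" by (rule less_mult_imp_div_less)
    then show "real (2 * N div d) - 2 * real (N div d) \<le> 1" by linarith
  qed
  also have "\<dots> \<le> real (card {p. prime p \<and> p \<le> 2 * N}) * ln (real (2 * N))"
    using sum_mangoldt_le[of "2 * N"] by simp
  finally show ?thesis .
qed

lemma card_primes_lower_bound:
  "\<forall>\<^sub>F x :: nat in sequentially. real (card {p. prime p \<and> p \<le> x}) \<ge> 1 / 4 * (x / ln x)"
proof -
  \<comment> \<open>The constant 51/100 is below ln 2 but above 1/2; the excess over 1/2 absorbs the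
    -1 lost in halving x.\<close>
  have E: "\<forall>\<^sub>F x :: nat in sequentially. 1 / 4 * x \<le> (x / 2 - 1) * (1/ 2 + 1/100) \<and> ln x > 0" 
    by (intro eventually_conj; real_asymp)
  show ?thesis using E eventually_ge_at_top[of 2]
  proof eventually_elim
    case (elim x)
    define N where "N = x div 2"
    have N: "N > 0" "2 * N \<le> x" "real x / 2 - 1 \<le> real N" using elim by (auto simp: N_def)
    have ln2: "1/ 2 + 1/100 \<le> ln (2::real)" using ln2_ge_two_thirds by simp
    have "1 / 4 * real x \<le> (real x / 2 - 1) * (1/ 2 + 1/100)" using elim by blast
    also have "\<dots> \<le> real N * ln 2" using N ln2 by (intro mult_mono) auto
    also have "\<dots> \<le> real (card {p. prime p \<and> p \<le> 2 * N}) * ln (real (2 * N))" by (rule card_primes_ge[OF N(1)])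
    also have "\<dots> \<le> real (card {p. prime p \<and> p \<le> x}) * ln (real x)"
    proof (intro mult_mono of_nat_mono card_mono ln_mono)
      show "finite {p. prime p \<and> p \<le> x}" by (rule finite_subset[of _ "{..x}"]) auto
    qed (use N in auto)
    finally show ?case using elim by (simp add: field_simps)
  qed
qed

section \<open>Concatenated values of tame functions\<close>

lemma ln_le_length_digits_of:
  assumes "g \<ge> 2" "m > 0"
  shows "ln (real m) / ln (real g) \<le> real (length (digits_of g m))"
    and "real (length (digits_of g m)) \<le> 1 + ln (real m) / ln (real g)"
proof -
  let ?l = "length (digits_of g m)"
  have g: "ln (real g) > 0" using assms(1) by simp
  have m: "real g ^ (?l - 1) \<le> real m" "real m < real g ^ ?l"
    using length_digits_of_bounds[OF assms] by (simp_all flip: of_nat_power)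
  have "ln (real m) \<le> ln (real g ^ ?l)" using m(2) assms by (intro ln_mono) auto
  then show "ln (real m) / ln (real g) \<le> real ?l" using g assms(1) by (simp add: ln_realpow field_simps)
  have "ln (real g ^ (?l - 1)) \<le> ln (real m)" using m(1) assms by (intro ln_mono) auto
  then have "real (?l - 1) \<le> ln (real m) / ln (real g)" using g assms(1) by (simp add: ln_realpow field_simps)
  moreover have "?l > 0" by simp
  ultimately show "real ?l \<le> 1 + ln (real m) / ln (real g)" by linarith
qed

text \<open>Small values and sparse values are treated alike: either set contains at most
  x^(1-\<delta>) integers, each with x^o(1) preimages in the good set. Discarding values below sqrt
  x makes the remaining expansions as long as a constant times ln x, so that exponential decay in
  the length becomes a power of x.\<close>

lemma few_exceptional_arguments:
  fixes \<epsilon> :: real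
  assumes g: "g \<ge> 2" and w: "w \<noteq> []" "set w \<subseteq> {..<g}" and \<epsilon>: "\<epsilon> > 0" and f: "tame f"
  shows "\<exists>C. \<forall>\<^sub>F x :: nat in sequentially.
    real (card {n\<in>{1..x}. real (f n) < sqrt x \<or>
      real (occurrences w (digits_of g (f n)))
        < (1 / real g ^ length w - \<epsilon>) * real (length (digits_of g (f n)))}) \<le> C * (x / ln x ^ 2)"
proof -
  define k where "k = length w"
  define W where "W = word_value g w"
  \<comment> \<open>The decay rate per digit for deviation \<epsilon>/2, multiplied by the minimal
    length ln x / (2 ln g).\<close>
  define \<eta> where "\<eta> = (\<epsilon> / 2)\<^sup>2 / 2 / real k / (2 * ln (real g))"
  define D where "D = real k * exp ((\<epsilon> / 2)\<^sup>2) * real g"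
  have k: "k > 0" using w(1) by (simp add: k_def)
  have W: "W < g ^ k" using word_value_less[OF g w(2)] by (simp add: W_def k_def)
  have lng: "ln (real g) > 0" using g by simp
  have \<eta>: "\<eta> > 0" using \<epsilon> k lng by (simp add: \<eta>_def)
  have D: "D > 0" using k g by (simp add: D_def)
  define bad where "bad = (\<lambda>m. real (occurrences w (digits_of g m))
        < (1 / real g ^ length w - \<epsilon>) * real (length (digits_of g m)))"
  obtain e where ev: "\<forall>\<^sub>F x :: nat in sequentially. \<exists>G \<subseteq> {1..x}.
     controlled f G (nat \<lfloor>x * ln x ^ e\<rfloor>) (nat \<lfloor>ln (ln x) ^ e\<rfloor>)
       (exp (ln (ln x) ^ e)) (x * ln x ^ e) (exp (ln (ln x) ^ e)) \<and>
     real (card ({1..x} - G)) \<le> e * (x / ln x ^ 2)"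
    using f unfolding tame_def by blast
  have E1: "\<forall>\<^sub>F x :: nat in sequentially. (sqrt x + 1) * exp (ln (ln x) ^ (e + 2)) \<le> x / ln x ^ 2"
    by real_asymp
  have E2: "\<forall>\<^sub>F x :: nat in sequentially. (2 + ln (x * ln x ^ e) / ln (real g)) *
      ((D * (x * ln x ^ e) * x powr (- \<eta>)) * exp (ln (ln x) ^ (e + 2))) \<le> x / ln x ^ 2"
    using \<eta> D lng by real_asymp
  have E3: "\<forall>\<^sub>F x :: nat in sequentially. 4 * real k / \<epsilon> \<le> ln x / (2 * ln (real g))"
    using lng by real_asymp
  have E4: "\<forall>\<^sub>F x :: nat in sequentially. x * ln x ^ e \<ge> 1" by real_asymp
  have E5: "\<forall>\<^sub>F x :: nat in sequentially. ln (ln x) \<ge> 1" by real_asymp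
  have "\<forall>\<^sub>F x :: nat in sequentially.
    real (card {n\<in>{1..x}. real (f n) < sqrt x \<or> bad (f n)}) \<le> (real e + 2) * (x / ln x ^ 2)"
    using ev E1 E2 E3 E4 eventually_gt_at_top[of 0] E5
  proof eventually_elim
    case (elim x)
    define Y where "Y = x * ln x ^ e"
    define H where "H = exp (ln (ln x) ^ (e + 2))"
    obtain G where G: "G \<subseteq> {1..x}"
        "controlled f G (nat \<lfloor>Y\<rfloor>) (nat \<lfloor>ln (ln x) ^ e\<rfloor>) (exp (ln (ln x) ^ e)) Y (exp (ln (ln x) ^ e))"
      and card_compl: "real (card ({1..x} - G)) \<le> e * (x / ln x ^ 2)"
      using elim(1) unfolding Y_def by blast
    have H: "exp (ln (ln x) ^ e) \<le> H"
      using elim(7) unfolding H_def exp_le_cancel_iff by (intro power_increasing) auto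
    have finG: "finite G" using G(1) by (rule finite_subset) simp
    have Y: "Y \<ge> 1" using elim(5) by (simp add: Y_def)
    have fn: "0 < f n" "real (f n) \<le> Y" if "n \<in> G" for n
    proof -
      show "0 < f n" using G(2) that by (simp add: controlled_def)
      have "f n \<le> nat \<lfloor>Y\<rfloor>" using G(2) that by (simp add: controlled_def)
      then have "real (f n) \<le> real (nat \<lfloor>Y\<rfloor>)" by (simp only: of_nat_le_iff)
      also have "\<dots> \<le> Y" using Y by simp
      finally show "real (f n) \<le> Y" .
    qed
    have fibre: "real (card {n\<in>G. f n \<in> B}) \<le> real (card B) * H" if "finite B" for B
    proof -
      have "real (card {n\<in>G. f n \<in> B}) \<le> (\<Sum>m\<in>B. H)"
        by (rule card_Union_le_sum[where B = "\<lambda>m. {n\<in>G. f n = m}"])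
           (use that finG G(2) H in \<open>auto simp: controlled_def intro: order_trans\<close>)
      then show ?thesis by simp
    qed
    \<comment> \<open>Deviation \<epsilon>/2 instead of \<epsilon>: the other half absorbs the end
      correction 2k as soon as l \<ge> 4k/\<epsilon>.\<close>
    define Bad where "Bad = (\<lambda>l. {m. m < g ^ l \<and> real (card {p. p + k \<le> l \<and> (m div g ^ p) mod g ^ k = W})
              \<le> (1 / real (g ^ k) - \<epsilon> / 2) * real l - 2 * real k})"
    define N where "N = 1 + ln Y / ln (real g)"
    \<comment> \<open>Lengths are fixed one at a time, since \<open>Bad l\<close> counts windows in
      a given length. There are only O(ln x) of them, and g^l \<le> g Y holds throughout.\<close>
    define I where "I = {l. ln x / (2 * ln (real g)) \<le> real l \<and> real l \<le> N}"
    have sub: "I \<subseteq> {..nat \<lfloor>N\<rfloor>}" by (auto simp: I_def le_nat_floor)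
    then have finI: "finite I" by (rule finite_subset) simp
    have "card I \<le> card {..nat \<lfloor>N\<rfloor>}" using sub by (intro card_mono) auto
    then have cI: "card I \<le> nat \<lfloor>N\<rfloor> + 1" by simp
    have "N \<ge> 0" using Y lng by (auto simp: N_def intro!: add_nonneg_nonneg divide_nonneg_nonneg)
    then have cardI: "real (card I) \<le> 2 + ln Y / ln (real g)" using cI unfolding N_def by linarith
    have len_in_I: "length (digits_of g (f n)) \<in> I" if n: "n \<in> G" "sqrt x \<le> real (f n)" for n
    proof -
      have "ln x / 2 = ln (sqrt x)" using elim(6) by (simp add: ln_sqrt)
      also have "\<dots> \<le> ln (real (f n))" using n elim(6) by (intro ln_mono) auto
      finally have "ln x / 2 / ln (real g) \<le> ln (real (f n)) / ln (real g)" using lng by (intro divide_right_mono) auto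
      then have 1: "ln x / (2 * ln (real g)) \<le> real (length (digits_of g (f n)))"
        using ln_le_length_digits_of(1)[OF g fn(1)[OF n(1)]] by simp
      have "ln (real (f n)) / ln (real g) \<le> ln Y / ln (real g)"
        using fn[OF n(1)] lng by (intro divide_right_mono ln_mono) auto
      then have "real (length (digits_of g (f n))) \<le> 1 + ln Y / ln (real g)"
        using ln_le_length_digits_of(2)[OF g fn(1)[OF n(1)]] by linarith
      with 1 show ?thesis by (simp add: I_def N_def)
    qed
    have in_Bad: "f n \<in> Bad (length (digits_of g (f n)))" if n: "n \<in> G" "sqrt x \<le> real (f n)" "bad (f n)" for n
    proof -
      define l where "l = length (digits_of g (f n))"
      have "ln x / (2 * ln (real g)) \<le> real l" using len_in_I[OF n(1,2)] by (simp add: I_def l_def)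
      then have "4 * real k / \<epsilon> \<le> real l" using elim(4) by linarith
      then have l: "2 * real k \<le> \<epsilon> / 2 * real l" using \<epsilon> by (simp add: field_simps)
      have "real (card {p. p + k \<le> l \<and> (f n div g ^ p) mod g ^ k = W}) \<le> real (occurrences w (digits_of g (f n)))"
        using occurrences_digits_of[OF g w, of "f n"] by (simp add: l_def k_def W_def)
      also have "\<dots> \<le> (1 / real g ^ k - \<epsilon>) * real l" using n(3) by (simp add: bad_def l_def k_def)
      also have "\<dots> \<le> (1 / real (g ^ k) - \<epsilon> / 2) * real l - 2 * real k"
        using l by (simp add: algebra_simps)
      finally show ?thesis
        using length_digits_of_bounds[OF g fn(1)[OF n(1)]] by (simp add: Bad_def l_def)
    qed
    have cardBad: "real (card (Bad l)) \<le> D * Y * x powr (- \<eta>)" if l: "l \<in> I" for l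
    proof -
      have "real (card (Bad l)) \<le> real k * exp ((\<epsilon> / 2)\<^sup>2) * (real g * exp (- ((\<epsilon> / 2)\<^sup>2 / 2) / real k)) ^ l"
        unfolding Bad_def using g k W \<epsilon> by (intro sparse_word_count) auto
      also have "\<dots> \<le> real k * exp ((\<epsilon> / 2)\<^sup>2) * ((real g * Y) * x powr (- \<eta>))"
        unfolding power_mult_distrib
      proof (rule mult_left_mono, rule mult_mono)
        have "ln (real g) * real l \<le> ln (real g) + ln Y" using l lng by (simp add: I_def N_def field_simps)
        then have "exp (ln (real g) * real l) \<le> exp (ln (real g) + ln Y)" by simp
        moreover have "real g > 0" using g by simp
        ultimately show "real g ^ l \<le> real g * Y" using Y by (simp add: exp_add exp_of_nat2_mult)
        have "(\<epsilon> / 2)\<^sup>2 / 2 / real k * (ln x / (2 * ln (real g))) \<le> (\<epsilon> / 2)\<^sup>2 / 2 / real k * real l"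
          using l by (intro mult_left_mono) (auto simp: I_def)
        then have "real l * (- ((\<epsilon> / 2)\<^sup>2 / 2) / real k) \<le> - \<eta> * ln x"
          by (simp add: \<eta>_def mult_ac)
        then have "exp (real l * (- ((\<epsilon> / 2)\<^sup>2 / 2) / real k)) \<le> exp (- \<eta> * ln x)" by (simp only: exp_le_cancel_iff)
        then show "exp (- ((\<epsilon> / 2)\<^sup>2 / 2) / real k) ^ l \<le> x powr (- \<eta>)"
          using elim(6) unfolding exp_of_nat_mult by (simp add: powr_def)
      qed (use Y g in auto)
      finally show ?thesis by (simp add: D_def mult_ac)
    qed
    let ?small = "{n\<in>G. f n \<in> {..nat \<lfloor>sqrt x\<rfloor>}}"
    have "{n\<in>{1..x}. real (f n) < sqrt x \<or> bad (f n)} \<subseteq> ({1..x} - G) \<union> ?small \<union> (\<Union>l\<in>I. {n\<in>G. f n \<in> Bad l})"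
    proof
      fix n assume n: "n \<in> {n\<in>{1..x}. real (f n) < sqrt x \<or> bad (f n)}"
      show "n \<in> ({1..x} - G) \<union> ?small \<union> (\<Union>l\<in>I. {n\<in>G. f n \<in> Bad l})"
      proof (cases "n \<in> G \<and> sqrt x \<le> real (f n)")
        case True
        then have "bad (f n)" using n by auto
        then have "n \<in> (\<Union>l\<in>I. {n\<in>G. f n \<in> Bad l})"
          using in_Bad[of n] len_in_I[of n] True by (intro UN_I[of "length (digits_of g (f n))"]) auto
        then show ?thesis by (rule UnI2)
      next
        case False
        then show ?thesis using n by (auto simp: le_nat_floor)
      qed
    qed
    then have "card {n\<in>{1..x}. real (f n) < sqrt x \<or> bad (f n)}
        \<le> card (({1..x} - G) \<union> ?small \<union> (\<Union>l\<in>I. {n\<in>G. f n \<in> Bad l}))"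
      using finG finI by (intro card_mono) auto
    also have "\<dots> \<le> card ({1..x} - G) + card ?small + card (\<Union>l\<in>I. {n\<in>G. f n \<in> Bad l})"
      by (meson card_Un_le order_trans add_right_mono)
    finally have "real (card {n\<in>{1..x}. real (f n) < sqrt x \<or> bad (f n)})
      \<le> real (card ({1..x} - G)) + real (card ?small) + real (card (\<Union>l\<in>I. {n\<in>G. f n \<in> Bad l}))"
      by linarith
    also have "real (card ?small) \<le> x / ln x ^ 2"
    proof -
      have "real (card ?small) \<le> real (card {..nat \<lfloor>sqrt x\<rfloor>}) * H" by (rule fibre) simp
      also have "\<dots> \<le> (sqrt x + 1) * H" by (intro mult_right_mono) (auto simp: H_def)
      finally show ?thesis using elim(2) unfolding H_def by linarith
    qed
    also have "real (card (\<Union>l\<in>I. {n\<in>G. f n \<in> Bad l})) \<le> x / ln x ^ 2"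
    proof -
      have "real (card (\<Union>l\<in>I. {n\<in>G. f n \<in> Bad l})) \<le> (\<Sum>l\<in>I. (D * Y * x powr (- \<eta>)) * H)"
      proof (rule card_Union_le_sum[OF subset_refl finI])
        fix l assume l: "l \<in> I"
        have "real (card {n\<in>G. f n \<in> Bad l}) \<le> real (card (Bad l)) * H"
          by (rule fibre) (simp add: Bad_def)
        also have "\<dots> \<le> (D * Y * x powr (- \<eta>)) * H"
          by (intro mult_right_mono cardBad l) (simp add: H_def)
        finally show "real (card {n\<in>G. f n \<in> Bad l}) \<le> \<dots>" .
      qed (use finG in auto)
      also have "\<dots> = real (card I) * ((D * Y * x powr (- \<eta>)) * H)" by simp
      also have "\<dots> \<le> (2 + ln Y / ln (real g)) * ((D * Y * x powr (- \<eta>)) * H)"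
        using cardI D Y by (intro mult_right_mono) (auto simp: H_def)
      finally show ?thesis using elim(3) unfolding H_def Y_def by linarith
    qed
    also note card_compl
    finally show ?case by (simp only: distrib_right) linarith
  qed
  then show ?thesis unfolding bad_def by blast
qed

text \<open>The density condition says that b has at least of order x / ln x terms up to x, which
  covers both the integers and the primes. Almost all of them yield blocks of length at least a
  constant times ln x, hence at least of order x digits in total. The O(x / (ln x)^2) exceptional
  blocks have only O(x / ln x) digits.\<close>

theorem normal_concat_tame:
  assumes g: "g \<ge> 2" and b: "strict_mono b" "b 0 > 0"
    and dense: "c > 0" "\<forall>\<^sub>F n in sequentially. c * (real (b n) / ln (real (b n))) \<le> real (Suc n)"
    and f: "tame f" "\<And>n. n > 0 \<Longrightarrow> f n > 0"
    and upper: "\<forall>\<^sub>F x :: nat in sequentially. \<forall>n\<in>{1..x}. real (f n) \<le> x * ln x ^ e"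
  shows "normal_in_base g (concat_real g (\<lambda>n. f (b n)))"
proof (rule normal_concat_real[OF g])
  fix w :: "nat list" and \<epsilon> :: real
  assume w: "w \<noteq> []" "set w \<subseteq> {..<g}" and \<epsilon>: "\<epsilon> > 0"
  let ?len = "\<lambda>m. real (length (digits_of g m))"
  define bad where "bad = (\<lambda>m. real (occurrences w (digits_of g m)) < (1 / real g ^ length w - \<epsilon>) * ?len m)"
  define E where "E = (\<lambda>x::nat. {n\<in>{1..x}. real (f n) < sqrt x \<or> bad (f n)})"
  obtain C where C: "\<forall>\<^sub>F x :: nat in sequentially. real (card (E x)) \<le> C * (x / ln x ^ 2)"
    using few_exceptional_arguments[OF g w \<epsilon> f(1)] unfolding bad_def E_def by blast
  have lng: "ln (real g) > 0" using g by simp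
  \<comment> \<open>Exceptional digits plus one unfinished block on the left, of order x / ln x;
    \<epsilon> times a lower bound for all digits on the right, of order x.\<close>
  have E1: "\<forall>\<^sub>F x :: nat in sequentially.
      (C * (x / ln x ^ 2) + 1) * (1 + ln (x * ln x ^ e) / ln (real g))
      \<le> \<epsilon> * ((c * (x / ln x) - 1 - C * (x / ln x ^ 2)) * (ln x / (2 * ln (real g))))"
    using lng \<epsilon> dense(1) by real_asymp
  have E2: "\<forall>\<^sub>F x :: nat in sequentially. x * ln x ^ e \<ge> 1" by real_asymp
  have E3: "\<forall>\<^sub>F x :: nat in sequentially. ln x \<ge> 1" by real_asymp
  have lim: "filterlim b sequentially sequentially" using b(1) by (rule filterlim_subseq)
  note comp = eventually_compose_filterlim[OF _ lim]
  have bpos: "b i > 0" for i using b strict_mono_less_eq[OF b(1), of 0 i] by simp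
  show "\<forall>\<^sub>F n in sequentially.
      (\<Sum>i | i < n \<and> real (occurrences w (digits_of g (f (b i)))) < (1 / real g ^ length w - \<epsilon>) * ?len (f (b i)).
          ?len (f (b i))) + ?len (f (b n)) \<le> \<epsilon> * (\<Sum>i<n. ?len (f (b i)))"
    using dense(2) comp[OF C] comp[OF upper] comp[OF E1] comp[OF E2] comp[OF E3]
  proof eventually_elim
    case (elim n)
    define x where "x = b n"
    define Y where "Y = x * ln x ^ e"
    define M where "M = 1 + ln Y / ln (real g)"
    note elim = elim[folded x_def, folded Y_def]
    have le: "b i \<le> x" if "i \<le> n" for i using that b(1) by (simp add: x_def strict_mono_less_eq)
    have M: "M \<ge> 0" using elim(5) lng by (simp add: M_def add_nonneg_nonneg)
    have len: "?len (f (b i)) \<le> M" if "i \<le> n" for i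
    proof -
      have "real (f (b i)) \<le> Y" using elim(3) le[OF that] bpos[of i] by (simp add: Suc_le_eq)
      then have "ln (real (f (b i))) / ln (real g) \<le> ln Y / ln (real g)"
        using f(2)[OF bpos[of i]] lng by (intro divide_right_mono ln_mono) auto
      then show ?thesis using ln_le_length_digits_of(2)[OF g f(2)[OF bpos[of i]]] by (simp add: M_def)
    qed
    define J where "J = {i. i < n \<and> b i \<in> E x}"
    have inj: "inj_on b A" for A using b(1) by (meson inj_on_subset strict_mono_imp_inj_on subset_UNIV)
    have "card J \<le> card (E x)"
      by (rule card_inj_on_le[OF inj]) (auto simp: J_def E_def)
    then have J: "real (card J) \<le> C * (x / ln x ^ 2)" using elim(2) by linarith
    have finJ: "finite J" by (simp add: J_def)
    have inE: "b i \<in> E x \<longleftrightarrow> real (f (b i)) < sqrt x \<or> bad (f (b i))" if "i < n" for i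
      using that le[of i] bpos[of i] by (auto simp: E_def Suc_le_eq)
    have "(\<Sum>i | i < n \<and> bad (f (b i)). ?len (f (b i))) \<le> (\<Sum>i\<in>J. ?len (f (b i)))"
      using inE finJ by (intro sum_mono2) (auto simp: J_def)
    also have "\<dots> \<le> (\<Sum>i\<in>J. M)" by (intro sum_mono len) (auto simp: J_def)
    also have "\<dots> = real (card J) * M" by simp
    finally have "(\<Sum>i | i < n \<and> bad (f (b i)). ?len (f (b i))) + ?len (f (b n)) \<le> real (card J) * M + M"
      using len[of n] by linarith
    also have "\<dots> = (real (card J) + 1) * M" by (simp only: distrib_right mult_1)
    also have "\<dots> \<le> (C * (x / ln x ^ 2) + 1) * M" using J M by (intro mult_right_mono) auto
    also have "\<dots> \<le> \<epsilon> * ((c * (x / ln x) - 1 - C * (x / ln x ^ 2)) * (ln x / (2 * ln (real g))))"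
      using elim(4) by (simp only: M_def)
    also have "\<dots> \<le> \<epsilon> * (\<Sum>i<n. ?len (f (b i)))"
    proof (rule mult_left_mono)
      have "(c * (x / ln x) - 1 - C * (x / ln x ^ 2)) * (ln x / (2 * ln (real g)))
          \<le> real (card ({..<n} - J)) * (ln x / (2 * ln (real g)))"
      proof (rule mult_right_mono)
        have "card ({..<n} - J) = n - card J"
          by (subst card_Diff_subset) (auto simp: finJ J_def)
        moreover have "card J \<le> n" using card_mono[of "{..<n}" J] by (auto simp: J_def)
        ultimately have "real (card ({..<n} - J)) = real n - real (card J)" by simp
        \<comment> \<open>The 1 is subtracted because the density hypothesis counts the n + 1 terms
          up to index n, whereas the block sum stops before n.\<close>
        then show "c * (x / ln x) - 1 - C * (x / ln x ^ 2) \<le> real (card ({..<n} - J))"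
          using elim(1) J by simp
        show "0 \<le> ln x / (2 * ln (real g))" using elim(6) lng by simp
      qed
      also have "\<dots> = (\<Sum>i\<in>{..<n} - J. ln x / (2 * ln (real g)))" by simp
      also have "\<dots> \<le> (\<Sum>i\<in>{..<n} - J. ?len (f (b i)))"
      proof (rule sum_mono)
        fix i assume "i \<in> {..<n} - J"
        then have "sqrt x \<le> real (f (b i))" using inE[of i] by (auto simp: J_def)
        then have "ln (sqrt x) \<le> ln (real (f (b i)))" using bpos[of n] by (intro ln_mono) (auto simp: x_def)
        then have "ln (sqrt x) / ln (real g) \<le> ln (real (f (b i))) / ln (real g)"
          using lng by (intro divide_right_mono) auto
        also have "\<dots> \<le> ?len (f (b i))" by (rule ln_le_length_digits_of(1)[OF g f(2)[OF bpos]])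
        finally show "ln x / (2 * ln (real g)) \<le> ?len (f (b i))"
          using bpos[of n] by (simp add: ln_sqrt x_def)
      qed
      also have "\<dots> \<le> (\<Sum>i<n. ?len (f (b i)))" by (intro sum_mono2) auto
      finally show "(c * (x / ln x) - 1 - C * (x / ln x ^ 2)) * (ln x / (2 * ln (real g))) \<le> (\<Sum>i<n. ?len (f (b i)))" .
    qed (use \<epsilon> in simp)
    finally show ?case by (simp only: bad_def)
  qed
qed

theorem theorem1p2:
  fixes g :: nat and f :: "nat \<Rightarrow> nat" and fs :: "(nat \<Rightarrow> nat) list"
  assumes "g \<ge> 2"
    and "fs \<noteq> []"
    and "set fs \<subseteq> {totient, divisor_sigma, Carmichael}"
    and "f = foldr (\<circ>) fs id"
  shows "normal_in_base g (concat_real g (\<lambda>n. f (Suc n))) \<and>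
         normal_in_base g (concat_real g (\<lambda>n. f (enumerate {p. prime p} n)))"
proof
  have f: "tame f" "\<And>n. n > 0 \<Longrightarrow> f n > 0"
    using tame_foldr positive_foldr assms(3,4) by blast+
  obtain e where upper: "\<forall>\<^sub>F x :: nat in sequentially. \<forall>n\<in>{1..x}. real (f n) \<le> x * ln x ^ e"
    using upper_foldr[OF assms(3)] assms(4) by blast
  show "normal_in_base g (concat_real g (\<lambda>n. f (Suc n)))"
  proof (rule normal_concat_tame[OF assms(1) _ _ _ _ f upper, where c = 1])
    show "strict_mono Suc" by (simp add: strict_mono_def)
    show "\<forall>\<^sub>F n in sequentially. 1 * (real (Suc n) / ln (real (Suc n))) \<le> real (Suc n)"
      by real_asymp
  qed auto
  define b where "b = enumerate {p::nat. prime p}"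
  have b: "strict_mono b" unfolding b_def by (rule strict_mono_enumerate) (rule primes_infinite)
  have prime_b: "prime (b n)" for n
    using enumerate_in_set[OF primes_infinite, of n] by (simp add: b_def)
  have "normal_in_base g (concat_real g (\<lambda>n. f (b n)))"
  proof (rule normal_concat_tame[OF assms(1) b _ _ _ f upper, where c = "1 / 4"])
    show "b 0 > 0" using prime_b prime_gt_0_nat by blast
    \<comment> \<open>Enumeration starts at index 0, so Chebyshev's bound at x = b n is literally
      the required density.\<close>
    have "card {p. prime p \<and> p \<le> b n} = Suc n" for n
    proof -
      have "{p. prime p \<and> p \<le> b n} = b ` {..n}"
      proof (intro equalityI subsetI)
        fix p assume p: "p \<in> {p. prime p \<and> p \<le> b n}"
        then obtain m where "p = b m" using enumerate_Ex[OF primes_infinite, of p] by (auto simp: b_def)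
        then show "p \<in> b ` {..n}" using p b by (auto simp: strict_mono_less_eq)
      qed (use prime_b b in \<open>auto simp: strict_mono_less_eq\<close>)
      then show ?thesis using b by (simp add: card_image strict_mono_imp_inj_on)
    qed
    then show "\<forall>\<^sub>F n in sequentially. 1 / 4 * (real (b n) / ln (real (b n))) \<le> real (Suc n)"
      using eventually_compose_filterlim[OF card_primes_lower_bound filterlim_subseq[OF b]] by simp
  qed simp
  then show "normal_in_base g (concat_real g (\<lambda>n. f (enumerate {p. prime p} n)))"
    by (simp add: b_def)
qed

end
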